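(* Let $n \geq 5$ and let $L$ be a principal ideal domain without $2$-torsion. Then the cohomology classes of the two crossed homomorphisms $f_M, f_K : \mathrm{Aut}\,F_n \to V_L$ (constructed from the Magnus representation and from a Magnus expansion respectively, as defined in the context) generate the $L$-module $H^1(\mathrm{Aut}\,F_n, V_L)$.
   Context: $F_n$ is the free group of rank $n$ with basis $x_1,\dots,x_n$; $\mathrm{Aut}\,F_n$ acts on $F_n$ from the right, written $x^{\sigma}$, so $x^{\sigma\tau}=(x^\sigma)^\tau$. The corresponding left action is written $\sigma(x) := x^{\sigma^{-1}}$. $H$ is the abelianization of $F_n$, with basis $e_1,\dots,e_n$ induced from $x_1,\dots,x_n$; $[x]$ is the class of $x\in F_n$ in $H$; $H^* = \mathrm{Hom}_{\mathbf{Z}}(H,\mathbf{Z})$ has dual basis $e_1^*,\dots,e_n^*$. $\mathrm{Aut}\,F_n$ acts on $H$ from the left via $\sigma\cdot[x] = [\sigma(x)]$, dually on $H^*$, and diagonally on tensor constructions. $V := \mathrm{IA}_n^{\mathrm{ab}}$, where $\mathrm{IA}_n = \ker(\mathrm{Aut}\,F_n\to\mathrm{Aut}\,H)$, is identified with $H^*\otimes_{\mathbf{Z}}\Lambda^2 H$ as a $\mathrm{GL}(n,\mathbf{Z})$-module via the first Johnson homomorphism $\sigma\mapsto([x]\mapsto x^{-1}x^\sigma)$, where the class of $x^{-1}x^\sigma$ is taken in $[F_n,F_n]/[F_n,[F_n,F_n]] \cong \Lambda^2 H$; $V_L := V\otimes_{\mathbf{Z}}L$ with $L$ a trivial $\mathrm{Aut}\,F_n$-module.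 "Without $2$-torsion" means that $2a=0$ with $a\in L$ implies $a=0$. A crossed homomorphism $f:G\to M$ into a left $G$-module satisfies $f(\sigma\tau)=f(\sigma)+\sigma\cdot f(\tau)$. Definition of $f_M$ (Morita). Let $\partial/\partial x_i:\mathbf{Z}[F_n]\to\mathbf{Z}[F_n]$ be Fox's free derivatives, let $\bar{\ }:\mathbf{Z}[F_n]\to\mathbf{Z}[F_n]$ be the antiautomorphism induced by $y\mapsto y^{-1}$ on $F_n$, and let $\mathfrak{a}:\mathbf{Z}[F_n]\to\mathbf{Z}[H]$ be the ring homomorphism induced by abelianization. The Magnus representation is the map $r_M:\mathrm{Aut}\,F_n\to\mathrm{GL}(n,\mathbf{Z}[H])$ sending $\sigma$ to the matrix whose $(i,j)$ entry is $\mathfrak{a}\big(\overline{\partial\sigma(x_j)/\partial x_i}\big)$. Let $\mathrm{sgn}(\sigma)\in\{\pm1\}$ be the determinant of the automorphism of $H$ induced by $\sigma$. Then $\sigma\mapsto \mathrm{sgn}(\sigma)\det(r_M(\sigma))$ takes values in the multiplicative subgroup $H\subset\mathbf{Z}[H]$ and, writing $H$ additively, is a crossed homomorphism $\mathrm{Aut}\,F_n\to H$. The map $f_M:\mathrm{Aut}\,F_n\to V_L$ is its composition with $H\to V\to V_L$, where $H\to V$ is the $\mathrm{GL}(n,\mathbf{Z})$-equivariant injection $e_i\mapsto\sum_{k\neq i}e_k^*\otimes e_k\wedge e_i$ (induced by the inclusion $\mathrm{Inn}\,F_n\hookrightarrow\mathrm{IA}_n$ on abelianizations) and $V\to V_L$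 is the natural map. Definition of $f_K$ (Kawazumi). Let $\widehat{T}=\prod_{m\ge0}H^{\otimes m}$ be the complete tensor algebra generated by $H$. A Magnus expansion is a group homomorphism $\theta$ from $F_n$ to the multiplicative group of elements of $\widehat{T}$ with constant term $1$ such that the degree-one component of $\theta(x)$ is $[x]$ for all $x\in F_n$. Let $\theta_2(x)\in H^{\otimes2}$ be the degree-two component of $\theta(x)$. Fix any Magnus expansion $\theta$. The first Johnson map $\tau_1^\theta:\mathrm{Aut}\,F_n\to \mathrm{Hom}_{\mathbf{Z}}(H,H^{\otimes2})=H^*\otimes_{\mathbf{Z}}H^{\otimes2}$ is the crossed homomorphism given by $\tau_1^\theta(\sigma)([x])=\theta_2(x)-|\sigma|^{\otimes2}\theta_2(\sigma^{-1}(x))$ for $x\in F_n$, where $|\sigma|^{\otimes2}$ is the automorphism of $H^{\otimes2}$ induced by $\sigma$. The map $f_K:\mathrm{Aut}\,F_n\to V_L$ is the composition of $\tau_1^\theta$ with the natural projection $H^*\otimes_{\mathbf{Z}}H^{\otimes2}\to H^*\otimes_{\mathbf{Z}}\Lambda^2H=V\to V_L$ induced by $a\otimes b\mapsto a\wedge b$. *)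

theory Defs
  imports "HOL-Analysis.Analysis" "HOL-Library.Poly_Mapping"
begin

section \<open>The free group\<close>

text \<open>
  The rank is \<^term>\<open>CARD('n)\<close> for a finite type \<^typ>\<open>'n\<close> indexing the basis. A word is a list of
  letters \<^term>\<open>(a, e)\<close>, standing for $x_a$ if $e$ is true and for $x_a^{-1}$ otherwise.
  The group law is written additively, because \<^class>\<open>group_add\<close> is the (not necessarily
  commutative) class of groups for which \<^typ>\<open>'g \<Rightarrow>\<^sub>0 int\<close> is the integral group ring.
\<close>

inductive word_eq :: "('a \<times> bool) list \<Rightarrow> ('a \<times> bool) list \<Rightarrow> bool" where
  refl: "word_eq u u"
| sym: "word_eq u v \<Longrightarrow> word_eq v u"
| trans: "word_eq u v \<Longrightarrow> word_eq v w \<Longrightarrow> word_eq u w"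
| cancel: "word_eq (u @ (a, e) # (a, \<not> e) # v) (u @ v)"

lemma equivp_word_eq: "equivp word_eq"
  by (intro equivpI reflpI sympI transpI) (auto intro: word_eq.intros)

lemma word_eq_append_left: "word_eq u v \<Longrightarrow> word_eq (w @ u) (w @ v)"
proof (induction rule: word_eq.induct)
  case (cancel u a e v)
  show ?case using word_eq.cancel[of "w @ u" a e v] by simp
qed (blast intro: word_eq.refl word_eq.sym word_eq.trans)+

lemma word_eq_append_right: "word_eq u v \<Longrightarrow> word_eq (u @ w) (v @ w)"
proof (induction rule: word_eq.induct)
  case (cancel u a e v)
  show ?case using word_eq.cancel[of u a e "v @ w"] by simp
qed (blast intro: word_eq.refl word_eq.sym word_eq.trans)+

lemma word_eq_append: "word_eq u v \<Longrightarrow> word_eq u' v' \<Longrightarrow> word_eq (u @ u') (v @ v')"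
  using word_eq_append_left word_eq_append_right word_eq.trans by blast

definition word_inv :: "('a \<times> bool) list \<Rightarrow> ('a \<times> bool) list" where
  "word_inv u = rev (map (\<lambda>(a, e). (a, \<not> e)) u)"

lemma word_eq_inv: "word_eq u v \<Longrightarrow> word_eq (word_inv u) (word_inv v)"
proof (induction rule: word_eq.induct)
  case (cancel u a e v)
  show ?case using word_eq.cancel[of "word_inv v" a e "word_inv u"] by (simp add: word_inv_def)
qed (blast intro: word_eq.refl word_eq.sym word_eq.trans)+

lemma word_eq_left_inv: "word_eq (word_inv u @ u) []"
proof (induction u)
  case Nil
  show ?case by (simp add: word_inv_def word_eq.refl)
next
  case (Cons l u)
  obtain a e where l: "l = (a, e)" by (cases l)
  have "word_eq (word_inv u @ (a, \<not> e) # (a, \<not> \<not> e) # u) (word_inv u @ u)"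
    by (rule word_eq.cancel)
  then show ?case using Cons.IH word_eq.trans by (auto simp: word_inv_def l)
qed

quotient_type 'a free_group = "('a \<times> bool) list" / word_eq
  by (rule equivp_word_eq)

instantiation free_group :: (type) group_add
begin

lift_definition zero_free_group :: "'a free_group" is "[]" .
lift_definition plus_free_group :: "'a free_group \<Rightarrow> 'a free_group \<Rightarrow> 'a free_group" is "(@)"
  by (rule word_eq_append)
lift_definition uminus_free_group :: "'a free_group \<Rightarrow> 'a free_group" is word_inv
  by (rule word_eq_inv)
definition minus_free_group :: "'a free_group \<Rightarrow> 'a free_group \<Rightarrow> 'a free_group" where
  "minus_free_group x y = x + (- y)"

instance
proof
  fix a b c :: "'a free_group"
  show "a + b + c = a + (b + c)" by transfer (simp add: word_eq.refl)
  show "0 + a = a" by transfer (simp add: word_eq.refl)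
  show "a + 0 = a" by transfer (simp add: word_eq.refl)
  show "- a + a = 0" by transfer (rule word_eq_left_inv)
  show "a + - b = a - b" by (simp add: minus_free_group_def)
qed

end

lift_definition fgen :: "'a \<Rightarrow> 'a free_group" is "\<lambda>a. [(a, True)]" .

lemma abs_free_group_Cons:
  "abs_free_group ((a, e) # u) = (if e then fgen a else - fgen a) + abs_free_group u"
  by (simp add: fgen.abs_eq uminus_free_group.abs_eq plus_free_group.abs_eq word_inv_def)

lemma free_group_induct [case_names zero gen inv_gen]:
  assumes "P 0" "\<And>a x. P x \<Longrightarrow> P (fgen a + x)" "\<And>a x. P x \<Longrightarrow> P (- fgen a + x)"
  shows "P x"
proof (induction x rule: free_group.abs_induct)
  fix u
  show "P (abs_free_group u)"
  proof (induction u)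
    case Nil
    then show ?case using assms(1) by (simp add: zero_free_group.abs_eq)
  next
    case (Cons l u)
    then show ?case using assms(2,3) by (cases l) (simp add: abs_free_group_Cons)
  qed
qed


section \<open>Abelianization\<close>

primrec word_ab :: "('n::finite \<times> bool) list \<Rightarrow> int ^ 'n" where
  "word_ab [] = 0"
| "word_ab (l # u) = (if snd l then axis (fst l) 1 else - axis (fst l) 1) + word_ab u"

lemma word_ab_append: "word_ab (u @ v) = word_ab u + word_ab v"
  by (induction u) (auto simp: algebra_simps)

text \<open>\<open>fab x\<close> is the class $[x] \in H$, with $H = \mathbf{Z}^n$ via $e_i = [x_i]$.\<close>

lift_definition fab :: "'n::finite free_group \<Rightarrow> int ^ 'n" is word_ab
  by (induct_tac rule: word_eq.induct) (auto simp: word_ab_append)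

lemma fab_zero [simp]: "fab 0 = 0"
  by transfer simp

lemma fab_add [simp]: "fab (x + y) = fab x + fab y"
  by transfer (rule word_ab_append)

lemma fab_gen [simp]: "fab (fgen a) = axis a 1"
  by transfer simp

lemma fab_uminus [simp]: "fab (- x) = - fab x"
  using fab_add[of "- x" x] by (simp add: eq_neg_iff_add_eq_0)


section \<open>The automorphism group\<close>

text \<open>
  An element $\sigma$ of $\mathrm{Aut}\,F_n$ is represented by its right action $x \mapsto x^\sigma$;
  hence \<open>\<sigma> * \<tau>\<close> means: first $\sigma$, then $\tau$.
\<close>

typedef 'n aut = "{s :: 'n free_group \<Rightarrow> 'n free_group. bij s \<and> (\<forall>x y. s (x + y) = s x + s y)}"
  morphisms ract Abs_aut
  by (rule exI[of _ "\<lambda>x. x"]) (auto simp: bij_def)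

setup_lifting type_definition_aut

instantiation aut :: (type) "{monoid_mult, inverse}"
begin

lift_definition one_aut :: "'n aut" is "\<lambda>x. x"
  by (auto simp: bij_def)
lift_definition times_aut :: "'n aut \<Rightarrow> 'n aut \<Rightarrow> 'n aut" is "\<lambda>s t. t \<circ> s"
  by (auto intro: bij_comp)
lift_definition inverse_aut :: "'n aut \<Rightarrow> 'n aut" is "\<lambda>s. inv s"
proof -
  fix s :: "'n free_group \<Rightarrow> 'n free_group"
  assume "bij s \<and> (\<forall>x y. s (x + y) = s x + s y)"
  then have s: "bij s" "\<And>x y. s (x + y) = s x + s y" by auto
  have "inv s (x + y) = inv s x + inv s y" for x y
    using s(2)[of "inv s x" "inv s y"] s(1)
    by (metis bij_inv_eq_iff)
  with s(1) show "bij (inv s) \<and> (\<forall>x y. inv s (x + y) = inv s x + inv s y)"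
    by (simp add: bij_imp_bij_inv)
qed
definition divide_aut :: "'n aut \<Rightarrow> 'n aut \<Rightarrow> 'n aut" where
  "divide_aut s t = s * inverse t"

instance
  by standard (transfer; auto simp: fun_eq_iff)+

end

lemma aut_inverse:
  fixes s :: "'n aut"
  shows "inverse s * s = 1" "s * inverse s = 1"
  by (transfer; auto simp: fun_eq_iff bij_def surj_f_inv_f)+

text \<open>The left action $\sigma(x) = x^{\sigma^{-1}}$.\<close>

definition lact :: "'n aut \<Rightarrow> 'n free_group \<Rightarrow> 'n free_group" where
  "lact s x = ract (inverse s) x"

lemma ract_add: "ract s (x + y) = ract s x + ract s y"
  by transfer simp

lemma lact_add: "lact s (x + y) = lact s x + lact s y"
  by (simp add: lact_def ract_add)

lemma lact_inverse: "lact (inverse s) x = ract s x"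
  unfolding lact_def by transfer (simp add: inv_inv_eq)

lemma lact_one: "lact 1 x = x"
  unfolding lact_def by transfer (simp add: inv_equality)

lemma lact_mult: "lact (s * t) x = lact s (lact t x)"
  unfolding lact_def by transfer (simp add: o_inv_distrib)

text \<open>The matrix of the automorphism $|\sigma|$ of $H$ induced by the left action.\<close>

definition H_mat :: "'n::finite aut \<Rightarrow> int ^ 'n ^ 'n" where
  "H_mat s = (\<chi> i j. fab (lact s (fgen j)) $ i)"

lemma H_mat_fab: "H_mat s *v fab x = fab (lact s x)"
proof -
  have gen: "H_mat s *v axis a 1 = fab (lact s (fgen a))" for a
    by (simp add: H_mat_def vec_eq_iff matrix_vector_mult_def axis_def if_distrib cong: if_cong)
  have z: "lact s 0 = 0" using lact_add[of s 0 0] by (metis add.right_neutral add_left_cancel)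
  have u: "lact s (- y) = - lact s y" for y
    using lact_add[of s "- y" y] z by (simp add: eq_neg_iff_add_eq_0)
  have diff: "H_mat s *v (v - w) = H_mat s *v v - H_mat s *v w" for v w
    by (simp add: vec_eq_iff matrix_vector_mult_def sum_subtractf right_diff_distrib)
  show ?thesis
    by (induction x rule: free_group_induct)
      (simp_all add: z u lact_add gen diff matrix_vector_right_distrib)
qed


section \<open>The module $V_L$\<close>

text \<open>
  $\Lambda^2 R^n$ for a commutative ring $R$: the alternating matrix $A$ stands for
  $\sum_{i<j} A_{ij}\, e_i \wedge e_j$, for any ordering of the basis, so that $a \wedge b$ is
  $(a_i b_j - a_j b_i)_{ij}$. This is $\Lambda^2 H \otimes R$, where $H = \mathbf{Z}^n$.
\<close>

definition alternating :: "'r::comm_ring_1 ^ 'n ^ 'n \<Rightarrow> bool" where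
  "alternating A \<longleftrightarrow> (\<forall>i. A $ i $ i = 0) \<and> (\<forall>i j. A $ i $ j + A $ j $ i = 0)"

lemma alternating_uminus:
  assumes "alternating A"
  shows "alternating (- A)"
proof -
  have "(- A) $ i $ j + (- A) $ j $ i = - (A $ i $ j + A $ j $ i)" for i j
    by simp
  with assms show ?thesis by (simp add: alternating_def del: minus_add_distrib)
qed

lemma alternating_add:
  assumes "alternating A" "alternating B"
  shows "alternating (A + B)"
proof -
  have "(A + B) $ i $ j + (A + B) $ j $ i
      = (A $ i $ j + A $ j $ i) + (B $ i $ j + B $ j $ i)" for i j
    by (simp add: ac_simps)
  with assms show ?thesis by (simp add: alternating_def)
qed

lemma alternating_diff: "alternating A \<Longrightarrow> alternating B \<Longrightarrow> alternating (A - B)"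
  using alternating_add[of A "- B"] alternating_uminus[of B] by simp

typedef (overloaded) ('n::finite, 'r::comm_ring_1) ext2 =
  "{A :: 'r ^ 'n ^ 'n. alternating A}"
  morphisms ext2_coeff Abs_ext2
  by (rule exI[of _ 0]) (simp add: alternating_def)

setup_lifting type_definition_ext2

instantiation ext2 :: (finite, comm_ring_1) ab_group_add
begin

lift_definition zero_ext2 :: "('a, 'b) ext2" is 0
  by (simp add: alternating_def)
lift_definition plus_ext2 :: "('a, 'b) ext2 \<Rightarrow> ('a, 'b) ext2 \<Rightarrow> ('a, 'b) ext2" is "(+)"
  by (rule alternating_add)
lift_definition uminus_ext2 :: "('a, 'b) ext2 \<Rightarrow> ('a, 'b) ext2" is uminus
  by (rule alternating_uminus)
lift_definition minus_ext2 :: "('a, 'b) ext2 \<Rightarrow> ('a, 'b) ext2 \<Rightarrow> ('a, 'b) ext2" is "(-)"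
  by (rule alternating_diff)

instance
  by standard (transfer; simp)+

end

lift_definition ext2_scale :: "'r::comm_ring_1 \<Rightarrow> ('n::finite, 'r) ext2 \<Rightarrow> ('n, 'r) ext2"
  is "\<lambda>r A. \<chi> i j. r * A $ i $ j"
  by (simp add: alternating_def flip: distrib_left)

lift_definition wedge :: "'r::comm_ring_1 ^ 'n::finite \<Rightarrow> 'r ^ 'n \<Rightarrow> ('n, 'r) ext2"
  is "\<lambda>a b. \<chi> i j. a $ i * b $ j - a $ j * b $ i"
  by (simp add: alternating_def)

text \<open>
  The matrix $T$ stands for the tensor $\sum_{i,j} T_{ij}\, e_i \otimes e_j$, and
  \<open>ext2_proj\<close> is the map $a \otimes b \mapsto a \wedge b$.
\<close>

lift_definition ext2_proj :: "'r::comm_ring_1 ^ 'n::finite ^ 'n \<Rightarrow> ('n, 'r) ext2"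
  is "\<lambda>T. T - transpose T"
  by (simp add: alternating_def transpose_def)

definition tensor2 :: "'r::comm_ring_1 ^ 'n::finite \<Rightarrow> 'r ^ 'n \<Rightarrow> 'r ^ 'n ^ 'n" where
  "tensor2 a b = (\<chi> i j. a $ i * b $ j)"

lemma ext2_proj_tensor2: "ext2_proj (tensor2 a b) = wedge a b"
  unfolding tensor2_def by transfer (auto simp: transpose_def vec_eq_iff)

text \<open>$M \otimes M$ on $R^n \otimes R^n$ and $\Lambda^2 M$ on $\Lambda^2 R^n$.\<close>

definition tensor2_map :: "'r::comm_ring_1 ^ 'n::finite ^ 'n \<Rightarrow> 'r ^ 'n ^ 'n \<Rightarrow> 'r ^ 'n ^ 'n" where
  "tensor2_map M T = M ** T ** transpose M"

lemma tensor2_map_nth: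
  "tensor2_map M T $ i $ j = (\<Sum>a\<in>UNIV. \<Sum>b\<in>UNIV. M $ i $ a * T $ a $ b * M $ j $ b)"
  unfolding tensor2_map_def matrix_matrix_mult_def transpose_def
  by (simp add: sum_distrib_right) (rule sum.swap)

lemma tensor2_map_tensor2: "tensor2_map M (tensor2 a b) = tensor2 (M *v a) (M *v b)"
  by (simp add: vec_eq_iff tensor2_map_nth tensor2_def matrix_vector_mult_def sum_product ac_simps)

lemma alternating_form_self:
  fixes A :: "'r::comm_ring_1 ^ 'n::finite ^ 'n"
  assumes "alternating A" "finite S"
  shows "(\<Sum>a\<in>S. \<Sum>b\<in>S. x a * A $ a $ b * x b) = 0"
  using assms(2)
proof (induction S rule: finite_induct)
  case (insert c S)
  have "(\<Sum>a\<in>S. x a * A $ a $ c * x c) + (\<Sum>b\<in>S. x c * A $ c $ b * x b)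
      = (\<Sum>a\<in>S. x a * x c * (A $ a $ c + A $ c $ a))"
    by (simp add: sum.distrib[symmetric] algebra_simps)
  also have "\<dots> = 0" using assms(1) by (simp add: alternating_def)
  finally have *: "(\<Sum>a\<in>S. x a * A $ a $ c * x c) = - (\<Sum>b\<in>S. x c * A $ c $ b * x b)"
    by (simp add: eq_neg_iff_add_eq_0)
  have "A $ c $ c = 0" using assms(1) by (simp add: alternating_def)
  with insert show ?case by (simp add: sum.distrib *)
qed simp

lift_definition ext2_map :: "'r::comm_ring_1 ^ 'n::finite ^ 'n \<Rightarrow> ('n, 'r) ext2 \<Rightarrow> ('n, 'r) ext2"
  is tensor2_map
proof -
  fix M A :: "'r ^ 'n ^ 'n"
  assume A: "alternating A"
  have "tensor2_map M A $ i $ j + tensor2_map M A $ j $ i = 0" for i j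
  proof -
    have "tensor2_map M A $ i $ j = (\<Sum>b\<in>UNIV. \<Sum>a\<in>UNIV. M $ i $ a * A $ a $ b * M $ j $ b)"
      unfolding tensor2_map_nth by (rule sum.swap)
    then have "tensor2_map M A $ i $ j + tensor2_map M A $ j $ i
        = (\<Sum>b\<in>UNIV. \<Sum>a\<in>UNIV. M $ i $ a * M $ j $ b * (A $ a $ b + A $ b $ a))"
      unfolding tensor2_map_nth[of M A j i] by (simp add: sum.distrib[symmetric] algebra_simps)
    also have "\<dots> = 0" using A by (simp add: alternating_def)
    finally show ?thesis .
  qed
  then show "alternating (tensor2_map M A)"
    using alternating_form_self[OF A, of UNIV "\<lambda>a. M $ i $ a" for i]
    by (simp add: alternating_def tensor2_map_nth)
qed

lemma ext2_map_wedge: "ext2_map M (wedge a b) = wedge (M *v a) (M *v b)"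
proof transfer
  fix M :: "'b ^ 'a ^ 'a" and a b :: "'b ^ 'a"
  have "(\<chi> i j. a $ i * b $ j - a $ j * b $ i) = tensor2 a b - tensor2 b a" for a b :: "'b ^ 'a"
    by (simp add: tensor2_def vec_eq_iff mult.commute)
  moreover have "tensor2_map M (S - T) = tensor2_map M S - tensor2_map M T" for S T
    by (simp add: vec_eq_iff tensor2_map_nth algebra_simps sum_subtractf)
  ultimately show "tensor2_map M (\<chi> i j. a $ i * b $ j - a $ j * b $ i) =
      (\<chi> i j. (M *v a) $ i * (M *v b) $ j - (M *v a) $ j * (M *v b) $ i)"
    by (simp only: tensor2_map_tensor2)
qed

text \<open>The natural map $\Lambda^2 H \to \Lambda^2 H \otimes R$.\<close>

lift_definition ext2_of_int :: "('n::finite, int) ext2 \<Rightarrow> ('n, 'r::comm_ring_1) ext2"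
  is "\<lambda>A. \<chi> i j. of_int (A $ i $ j)"
  by (simp add: alternating_def flip: of_int_add)

text \<open>
  $V_R = H^* \otimes \Lambda^2 H \otimes R$, seen as $\mathrm{Hom}(H, \Lambda^2 H \otimes R)$:
  the family $v$ is the homomorphism $e_k \mapsto v_k$, that is, $\sum_k e_k^* \otimes v_k$.
  In particular \<^term>\<open>axis k w\<close> is $e_k^* \otimes w$.
\<close>

type_synonym ('n, 'r) VL = "('n, 'r) ext2 ^ 'n"

definition VL_scale :: "'r::comm_ring_1 \<Rightarrow> ('n::finite, 'r) VL \<Rightarrow> ('n, 'r) VL" where
  "VL_scale r v = (\<chi> k. ext2_scale r (v $ k))"

definition VL_of_int :: "('n::finite, int) VL \<Rightarrow> ('n, 'r::comm_ring_1) VL" where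
  "VL_of_int v = (\<chi> k. ext2_of_int (v $ k))"

text \<open>
  The diagonal action, which on homomorphisms is $(\sigma \cdot v)(h) =
  \Lambda^2|\sigma|\,(v(|\sigma|^{-1} h))$, evaluated at $h = e_k$.
\<close>

definition VL_act :: "'n::finite aut \<Rightarrow> ('n, 'r::comm_ring_1) VL \<Rightarrow> ('n, 'r) VL" where
  "VL_act s v = (\<chi> k. ext2_map (\<chi> i j. of_int (H_mat s $ i $ j))
     (\<Sum>l\<in>UNIV. ext2_scale (of_int (H_mat (inverse s) $ l $ k)) (v $ l)))"

lemma ext2_scale_simps:
  "ext2_scale r (a + b) = ext2_scale r a + ext2_scale r b"
  "ext2_scale (r + q) a = ext2_scale r a + ext2_scale q a"
  "ext2_scale r (ext2_scale q a) = ext2_scale (r * q) a"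
  "ext2_scale 1 a = a"
  by (transfer; simp add: vec_eq_iff algebra_simps)+

lemma ext2_scale_zero: "ext2_scale r 0 = 0"
  by transfer (simp add: vec_eq_iff)

lemma ext2_scale_sum: "ext2_scale r (sum f S) = (\<Sum>l\<in>S. ext2_scale r (f l))"
  by (induction S rule: infinite_finite_induct) (auto simp: ext2_scale_simps ext2_scale_zero)

lemma ext2_map_add: "ext2_map M (a + b) = ext2_map M a + ext2_map M b"
  by transfer (simp add: vec_eq_iff tensor2_map_nth algebra_simps sum.distrib)

lemma ext2_map_scale: "ext2_map M (ext2_scale r a) = ext2_scale r (ext2_map M a)"
  by transfer (simp add: vec_eq_iff tensor2_map_nth sum_distrib_left ac_simps)

lemma VL_act_add: "VL_act s (v + w) = VL_act s v + VL_act s w"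
  by (simp add: VL_act_def vec_eq_iff ext2_scale_simps sum.distrib ext2_map_add)

lemma VL_act_scale: "VL_act s (VL_scale r v) = VL_scale r (VL_act s v)"
  by (simp add: VL_act_def VL_scale_def vec_eq_iff ext2_scale_simps ext2_scale_sum
      ac_simps flip: ext2_map_scale)

lemma VL_act_zero: "VL_act s 0 = 0"
  using VL_act_add[of s 0 0] by simp

lemma VL_act_diff: "VL_act s (v - w) = VL_act s v - VL_act s w"
  using VL_act_add[of s "v - w" w] by (simp add: algebra_simps)

lemma VL_scale_simps:
  "VL_scale r (v + w) = VL_scale r v + VL_scale r w"
  "VL_scale (r + q) v = VL_scale r v + VL_scale q v"
  "VL_scale r (VL_scale q v) = VL_scale (r * q) v"
  "VL_scale 1 v = v"
  by (simp_all add: VL_scale_def vec_eq_iff ext2_scale_simps)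

lemma VL_scale_diff: "VL_scale r (v - w) = VL_scale r v - VL_scale r w"
  using VL_scale_simps(1)[of r "v - w" w] by (simp add: algebra_simps)


section \<open>First cohomology\<close>

definition crossed_hom :: "('n::finite aut \<Rightarrow> ('n, 'r::comm_ring_1) VL) \<Rightarrow> bool" where
  "crossed_hom f \<longleftrightarrow> (\<forall>s t. f (s * t) = f s + VL_act s (f t))"

definition principal_crossed_hom :: "('n::finite aut \<Rightarrow> ('n, 'r::comm_ring_1) VL) \<Rightarrow> bool" where
  "principal_crossed_hom f \<longleftrightarrow> (\<exists>m. \<forall>s. f s = VL_act s m - m)"

text \<open>
  The quotient of all maps $\mathrm{Aut}\,F_n \to V_R$ by the principal crossed homomorphisms;
  $H^1$ is the submodule formed by the classes of the crossed homomorphisms.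
\<close>

definition cohomologous ::
  "('n::finite aut \<Rightarrow> ('n, 'r::comm_ring_1) VL) \<Rightarrow> ('n aut \<Rightarrow> ('n, 'r) VL) \<Rightarrow> bool" where
  "cohomologous f g \<longleftrightarrow> principal_crossed_hom (\<lambda>s. f s - g s)"

lemma principal_zero: "principal_crossed_hom (\<lambda>s. 0)"
  unfolding principal_crossed_hom_def
  by (rule exI[of _ 0]) (simp add: VL_act_zero)

lemma principal_diff:
  assumes "principal_crossed_hom f" "principal_crossed_hom g"
  shows "principal_crossed_hom (\<lambda>s. f s - g s)"
proof -
  obtain m k where "\<And>s. f s = VL_act s m - m" "\<And>s. g s = VL_act s k - k"
    using assms unfolding principal_crossed_hom_def by blast
  then have "\<forall>s. f s - g s = VL_act s (m - k) - (m - k)"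
    by (simp add: VL_act_diff)
  then show ?thesis unfolding principal_crossed_hom_def by blast
qed

lemma principal_uminus: "principal_crossed_hom f \<Longrightarrow> principal_crossed_hom (\<lambda>s. - f s)"
  using principal_diff[OF principal_zero, of f] by simp

lemma principal_add:
  "principal_crossed_hom f \<Longrightarrow> principal_crossed_hom g \<Longrightarrow> principal_crossed_hom (\<lambda>s. f s + g s)"
  using principal_diff[of f "\<lambda>s. - g s"] principal_uminus[of g] by simp

lemma principal_scale:
  "principal_crossed_hom f \<Longrightarrow> principal_crossed_hom (\<lambda>s. VL_scale r (f s))"
  unfolding principal_crossed_hom_def by (metis VL_act_scale VL_scale_diff)

lemma equivp_cohomologous: "equivp cohomologous"
proof (intro equivpI reflpI sympI transpI)
  fix f g h :: "'n::finite aut \<Rightarrow> ('n, 'r::comm_ring_1) VL"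
  show "cohomologous f f" by (simp add: cohomologous_def principal_zero)
  show "cohomologous g f" if "cohomologous f g"
    using principal_uminus[of "\<lambda>s. f s - g s"] that by (simp add: cohomologous_def)
  show "cohomologous f h" if "cohomologous f g" "cohomologous g h"
    using principal_add[of "\<lambda>s. f s - g s" "\<lambda>s. g s - h s"] that by (simp add: cohomologous_def)
qed

quotient_type (overloaded) ('n, 'r) coh = "'n::finite aut \<Rightarrow> ('n, 'r::comm_ring_1) VL" / cohomologous
  morphisms rep_coh coh_class
  by (rule equivp_cohomologous)

instantiation coh :: (finite, comm_ring_1) ab_group_add
begin

lift_definition zero_coh :: "('a, 'b) coh" is "\<lambda>s. 0" .
lift_definition plus_coh :: "('a, 'b) coh \<Rightarrow> ('a, 'b) coh \<Rightarrow> ('a, 'b) coh" is "\<lambda>f g s. f s + g s"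
  unfolding cohomologous_def by (drule (1) principal_add) (simp add: algebra_simps)
lift_definition uminus_coh :: "('a, 'b) coh \<Rightarrow> ('a, 'b) coh" is "\<lambda>f s. - f s"
  unfolding cohomologous_def by (drule principal_uminus) (simp add: algebra_simps)
lift_definition minus_coh :: "('a, 'b) coh \<Rightarrow> ('a, 'b) coh \<Rightarrow> ('a, 'b) coh" is "\<lambda>f g s. f s - g s"
  unfolding cohomologous_def by (drule (1) principal_diff) (simp add: algebra_simps)

instance
  by standard (transfer; simp add: cohomologous_def principal_zero algebra_simps)+

end

lift_definition coh_scale :: "'r::comm_ring_1 \<Rightarrow> ('n::finite, 'r) coh \<Rightarrow> ('n, 'r) coh"
  is "\<lambda>r f s. VL_scale r (f s)"
  unfolding cohomologous_def by (drule principal_scale) (simp add: VL_scale_diff)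

text \<open>Submodules and spans for \<^term>\<open>(*)\<close> are the ideals and generated ideals of the ring.\<close>

lemma module_times: "module ((*) :: 'r::comm_ring_1 \<Rightarrow> 'r \<Rightarrow> 'r)"
  by unfold_locales (simp_all add: algebra_simps)

interpretation coh: module coh_scale
  by unfold_locales
    (transfer; simp add: VL_scale_simps cohomologous_def principal_zero)+

definition H1 :: "('n::finite, 'r::comm_ring_1) coh set" where
  "H1 = coh_class ` Collect crossed_hom"

lemma subspace_H1: "coh.subspace (H1 :: ('n::finite, 'r::comm_ring_1) coh set)"
proof (rule coh.subspaceI)
  have "crossed_hom (\<lambda>s :: 'n aut. 0 :: ('n, 'r) VL)"
    by (simp add: crossed_hom_def VL_act_zero)
  then show "(0 :: ('n, 'r) coh) \<in> H1"
    unfolding H1_def zero_coh.abs_eq by blast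
next
  fix x y :: "('n, 'r) coh"
  assume "x \<in> H1" "y \<in> H1"
  then obtain f g where "x = coh_class f" "y = coh_class g" "crossed_hom f" "crossed_hom g"
    by (auto simp: H1_def)
  moreover from this have "crossed_hom (\<lambda>s. f s + g s)"
    by (simp add: crossed_hom_def VL_act_add algebra_simps)
  ultimately show "x + y \<in> H1" by (auto simp: H1_def plus_coh.abs_eq)
next
  fix r and x :: "('n, 'r) coh"
  assume "x \<in> H1"
  then obtain f where "x = coh_class f" "crossed_hom f" by (auto simp: H1_def)
  moreover from this have "crossed_hom (\<lambda>s. VL_scale r (f s))"
    by (simp add: crossed_hom_def VL_act_scale VL_scale_simps)
  ultimately show "coh_scale r x \<in> H1" by (auto simp: H1_def coh_scale.abs_eq)
qed


section \<open>Morita's crossed homomorphism\<close>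

primrec word_fox :: "'n \<Rightarrow> ('n \<times> bool) list \<Rightarrow> 'n free_group \<Rightarrow>\<^sub>0 int" where
  "word_fox i [] = 0"
| "word_fox i (l # u) =
     (if snd l then (if fst l = i then 1 else 0) + frag_of (fgen (fst l)) * word_fox i u
      else (if fst l = i then - frag_of (- fgen i) else 0) + frag_of (- fgen (fst l)) * word_fox i u)"

lemma frag_of_mult: "frag_of x * frag_of y = frag_of (x + y)"
  by (simp add: mult_single)

lemma frag_of_zero: "frag_of 0 = (1 :: 'a::monoid_add \<Rightarrow>\<^sub>0 int)"
  by simp

lemma word_fox_append:
  "word_fox i (u @ v) = word_fox i u + frag_of (abs_free_group u) * word_fox i v"
proof (induction u)
  case Nil
  then show ?case by (simp flip: zero_free_group.abs_eq)
next
  case (Cons l u)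
  obtain a e where l: "l = (a, e)" by (cases l)
  show ?case
    by (auto simp: Cons.IH l abs_free_group_Cons distrib_left mult.assoc[symmetric] frag_of_mult)
qed

text \<open>
  \<open>fox i\<close> is $\partial/\partial x_i$ on group elements; on $\mathbf{Z}[F_n]$ it is extended
  linearly. The lemmas below are its defining properties.
\<close>

lift_definition fox :: "'n \<Rightarrow> 'n free_group \<Rightarrow> 'n free_group \<Rightarrow>\<^sub>0 int" is word_fox
proof -
  fix i :: 'n and u v :: "('n \<times> bool) list"
  assume "word_eq u v"
  then show "word_fox i u = word_fox i v"
  proof (induction rule: word_eq.induct)
    case (cancel u a e v)
    have "word_fox i ((a, e) # (a, \<not> e) # v) = word_fox i v"
      by (simp add: distrib_left mult.assoc[symmetric] frag_of_mult)
    then show ?case by (simp only: word_fox_append)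
  qed simp_all
qed

lemma fox_gen: "fox i (fgen j) = (if i = j then 1 else 0)"
  by transfer simp

lemma fox_add: "fox i (x + y) = fox i x + frag_of x * fox i y"
  by (induction x rule: free_group.abs_induct, induction y rule: free_group.abs_induct)
    (simp add: plus_free_group.abs_eq fox.abs_eq word_fox_append)

definition fox_derivative :: "'n \<Rightarrow> ('n free_group \<Rightarrow>\<^sub>0 int) \<Rightarrow> ('n free_group \<Rightarrow>\<^sub>0 int)" where
  "fox_derivative i = frag_extend (fox i)"

definition group_ring_bar :: "('g::group_add \<Rightarrow>\<^sub>0 int) \<Rightarrow> ('g \<Rightarrow>\<^sub>0 int)" where
  "group_ring_bar = frag_extend (\<lambda>x. frag_of (- x))"

definition group_ring_ab :: "('n::finite free_group \<Rightarrow>\<^sub>0 int) \<Rightarrow> ((int ^ 'n) \<Rightarrow>\<^sub>0 int)" where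
  "group_ring_ab = frag_extend (\<lambda>x. frag_of (fab x))"

definition magnus_rep :: "'n::finite aut \<Rightarrow> ((int ^ 'n) \<Rightarrow>\<^sub>0 int) ^ 'n ^ 'n" where
  "magnus_rep s = (\<chi> i j.
     group_ring_ab (group_ring_bar (fox_derivative i (frag_of (lact s (fgen j))))))"

text \<open>
  The element $h \in H$, written additively, with
  $\mathrm{sgn}(\sigma) \det r_M(\sigma) = h \in H \subset \mathbf{Z}[H]$.
\<close>

definition morita_H :: "'n::finite aut \<Rightarrow> int ^ 'n" where
  "morita_H s = (THE h. of_int (det (H_mat s)) * det (magnus_rep s) = frag_of h)"

text \<open>The linear map $H \to V$ with $e_i \mapsto \sum_{k \neq i} e_k^* \otimes e_k \wedge e_i$.\<close>

definition H_to_V :: "int ^ 'n::finite \<Rightarrow> ('n, int) VL" where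
  "H_to_V h = (\<Sum>i\<in>UNIV. VL_scale (h $ i) (\<Sum>k\<in>UNIV - {i}. axis k (wedge (axis k 1) (axis i 1))))"

definition f_M :: "'n::finite aut \<Rightarrow> ('n, 'r::comm_ring_1) VL" where
  "f_M s = VL_of_int (H_to_V (morita_H s))"


section \<open>Kawazumi's crossed homomorphism\<close>

text \<open>
  An element of $\widehat{T} = \prod_m H^{\otimes m}$ is given by its coefficients: the one at the
  list $[i_1, \dots, i_m]$ is the coefficient of $e_{i_1} \otimes \dots \otimes e_{i_m}$.
\<close>

type_synonym 'n ctensor = "'n list \<Rightarrow> int"

definition ctensor_mult :: "'n ctensor \<Rightarrow> 'n ctensor \<Rightarrow> 'n ctensor" where
  "ctensor_mult a b = (\<lambda>w. \<Sum>k\<le>length w. a (take k w) * b (drop k w))"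

definition magnus_expansion :: "('n::finite free_group \<Rightarrow> 'n ctensor) \<Rightarrow> bool" where
  "magnus_expansion \<theta> \<longleftrightarrow>
     (\<forall>x y. \<theta> (x + y) = ctensor_mult (\<theta> x) (\<theta> y)) \<and>
     (\<forall>x. \<theta> x [] = 1) \<and>
     (\<forall>x i. \<theta> x [i] = fab x $ i)"

definition degree2 :: "'n::finite ctensor \<Rightarrow> int ^ 'n ^ 'n" where
  "degree2 a = (\<chi> i j. a [i, j])"

definition johnson_map ::
  "('n::finite free_group \<Rightarrow> 'n ctensor) \<Rightarrow> 'n aut \<Rightarrow> int ^ 'n \<Rightarrow> int ^ 'n ^ 'n" where
  "johnson_map \<theta> s = (THE \<phi>. \<forall>x. \<phi> (fab x) =
     degree2 (\<theta> x) - tensor2_map (H_mat s) (degree2 (\<theta> (lact (inverse s) x))))"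

definition f_K :: "('n::finite free_group \<Rightarrow> 'n ctensor) \<Rightarrow> 'n aut \<Rightarrow> ('n, 'r::comm_ring_1) VL" where
  "f_K \<theta> s = VL_of_int (\<chi> k. ext2_proj (johnson_map \<theta> s (axis k 1)))"

end

(*
  By Nielsen's theorem, Aut F_n is generated by the permutations and sign changes of the basis
  together with one transvection E : x_p -> x_p x_q. The central symmetry x_a -> x_a^{-1} acts on
  V by -1 and commutes with the signed permutations; hence if f is a crossed homomorphism and m
  its value at the symmetry, then g = 2 f + delta m vanishes on all signed permutations and is
  determined by g(E). Now g(E) is fixed by the signed permutations fixing x_p and x_q, and
  conjugating E by the sign change at q gives its inverse. This leaves only the coefficients of
  e_p^* (x) e_p ^ e_q and of sum_{c <> p, q} e_c^* (x) e_c ^ e_q, and the same normalization of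
  f_M and f_K realizes both. So 2 (f - alpha f_M) = beta f_K + delta m'. Reducing modulo 2, and
  comparing coefficients on permutations and on E, shows that beta and m' are even after m' is
  corrected by the coboundary that normalizes f_K, and one divides by 2.
*)

theory Submission
  imports Defs
begin

section \<open>Reduced words\<close>

text \<open>Normalizing by the central symmetry costs a factor 2, and 2 need not be a unit of the
  coefficient ring, so the final division has to be earned by congruences. The two classes differ in
  this respect. Before the passage to V, f_M takes the sign change at S to the sum of the e_a with a
  in S, which is -1/2 times a coboundary value, that of the vector (1,...,1); so f_M is normalized
  only after doubling. For f_K the coboundary of the expansion's own degree-two part on the basis
  does it without doubling. Hence the doubled f matches the doubled f_M with an undivided
  coefficient, and only the coefficient of f_K has to be shown even. Modulo 2 this works because the
  normalized f_K vanishes on permutations and, on E, away from e_p^* (x) e_p ^ e_q: every other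
  coefficient tests m' directly. Nielsen's theorem is proved by minimization: once no elementary
  move lowers the total length of the images of the letters, with ties broken by an order on half
  words, a reduced word is never longer than its image. The inverse then takes letters to
  letters.\<close>

definition linv :: "'a \<times> bool \<Rightarrow> 'a \<times> bool" where
  "linv l = (fst l, \<not> snd l)"

lemma linv_linv [simp]: "linv (linv l) = l"
  by (simp add: linv_def)

lemma fst_linv [simp]: "fst (linv l) = fst l"
  by (simp add: linv_def)

lemma linv_neq [simp]: "linv l \<noteq> l" "l \<noteq> linv l"
  by (cases l; simp add: linv_def)+

lemma word_inv_linv: "word_inv u = rev (map linv u)"
  by (simp add: word_inv_def linv_def case_prod_beta')

lemma word_inv_simps [simp]:
  "word_inv [] = []" "word_inv (u @ v) = word_inv v @ word_inv u"
  "length (word_inv u) = length u" "word_inv (word_inv u) = u" "word_inv [l] = [linv l]"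
  by (simp_all add: word_inv_linv rev_map o_def)

abbreviation reduced :: "('a \<times> bool) list \<Rightarrow> bool" where
  "reduced \<equiv> successively (\<lambda>l l'. l' \<noteq> linv l)"

lemma reduced_word_inv: "reduced u \<Longrightarrow> reduced (word_inv u)"
  unfolding word_inv_linv successively_rev successively_map
  by (erule successively_mono) (metis linv_linv)

definition rcons :: "'a \<times> bool \<Rightarrow> ('a \<times> bool) list \<Rightarrow> ('a \<times> bool) list" where
  "rcons l u = (if u \<noteq> [] \<and> hd u = linv l then tl u else l # u)"

lemma reduced_rcons: "reduced u \<Longrightarrow> reduced (rcons l u)"
  by (cases u) (auto simp: rcons_def successively_Cons)

lemma rcons_rcons: "reduced u \<Longrightarrow> rcons l (rcons (linv l) u) = u"
  by (cases u) (auto simp: rcons_def successively_Cons)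

definition word_norm :: "('a \<times> bool) list \<Rightarrow> ('a \<times> bool) list" where
  "word_norm u = foldr rcons u []"

lemma reduced_word_norm: "reduced (word_norm u)"
  unfolding word_norm_def by (induction u) (auto intro: reduced_rcons)

lemma word_norm_reduced: "reduced u \<Longrightarrow> word_norm u = u"
  unfolding word_norm_def by (induction u) (auto simp: rcons_def successively_Cons)

lemma word_eq_rcons: "word_eq (l # u) (rcons l u)"
proof (cases "u \<noteq> [] \<and> hd u = linv l")
  case True
  then have "u = linv l # tl u" by (metis list.collapse)
  then show ?thesis
    using word_eq.cancel[of "[]" "fst l" "snd l" "tl u"] True
    by (simp add: rcons_def linv_def)
qed (auto simp: rcons_def intro: word_eq.refl)

lemma word_eq_word_norm: "word_eq u (word_norm u)"
proof (induction u)
  case (Cons l u)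
  have "word_eq (l # u) (l # word_norm u)"
    using word_eq_append_left[OF Cons.IH, of "[l]"] by simp
  then show ?case
    using word_eq_rcons word_eq.trans by (fastforce simp: word_norm_def)
qed (simp add: word_norm_def word_eq.refl)

text \<open>Van der Waerden's argument: prepending a letter with cancellation acts on reduced words,
  and opposite letters act as inverse permutations. So the fold depends only on the class of the
  word, and reduced forms are unique.\<close>

lift_definition rword :: "'a free_group \<Rightarrow> ('a \<times> bool) list" is word_norm
proof -
  fix u v :: "('a \<times> bool) list"
  assume "word_eq u v"
  then show "word_norm u = word_norm v"
  proof (induction rule: word_eq.induct)
    case (cancel u a e v)
    have "rcons (a, e) (rcons (a, \<not> e) (word_norm v)) = word_norm v"
      using rcons_rcons[OF reduced_word_norm, of "(a, e)" v] by (simp add: linv_def)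
    then show ?case by (simp add: word_norm_def)
  qed simp_all
qed

lemma reduced_rword [simp]: "reduced (rword x)"
  by transfer (rule reduced_word_norm)

lemma rword_abs: "reduced u \<Longrightarrow> rword (abs_free_group u) = u"
  by (simp add: rword.abs_eq word_norm_reduced)

lemma abs_rword [simp]: "abs_free_group (rword x) = x"
  by (induction x rule: free_group.abs_induct)
    (metis free_group.abs_eq_iff rword.abs_eq word_eq.sym word_eq_word_norm)

lemma rword_inject [simp]: "rword x = rword y \<longleftrightarrow> x = y"
  by (metis abs_rword)

lemma rword_zero [simp]: "rword 0 = []"
  by transfer (simp add: word_norm_def)

lemma rword_eq_Nil [simp]: "rword x = [] \<longleftrightarrow> x = 0"
  by (metis rword_inject rword_zero)

lemma rword_uminus: "rword (- x) = word_inv (rword x)"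
  by (metis abs_rword reduced_rword reduced_word_inv rword_abs uminus_free_group.abs_eq)

abbreviation fletter :: "'a \<times> bool \<Rightarrow> 'a free_group" where
  "fletter l \<equiv> abs_free_group [l]"

lemma fletter_simps: "fletter (a, True) = fgen a" "fletter (a, False) = - fgen a"
  by (simp_all add: fgen.abs_eq uminus_free_group.abs_eq word_inv_linv linv_def)

lemma fletter_linv: "fletter (linv l) = - fletter l"
  by (simp add: uminus_free_group.abs_eq)

lemma fletter_if: "fletter l = (if snd l then fgen (fst l) else - fgen (fst l))"
  by (cases l; cases "snd l") (auto simp: fletter_simps)

lemma rword_fletter [simp]: "rword (fletter l) = [l]"
  by (simp add: rword_abs)

lemma fletter_inject [simp]: "fletter l = fletter l' \<longleftrightarrow> l = l'"
  by (metis rword_fletter list.inject)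

lemma fgen_inject [simp]: "fgen a = fgen b \<longleftrightarrow> a = b"
  by (metis fletter_simps(1) fletter_inject prod.inject)

lemma fletter_neq_zero [simp]: "fletter l \<noteq> 0"
  by (metis list.distinct(1) rword_fletter rword_zero)

lemma fgen_neq_zero [simp]: "fgen a \<noteq> 0"
  by (metis fletter_neq_zero fletter_simps(1))

lemma abs_free_group_append: "abs_free_group (u @ v) = abs_free_group u + abs_free_group v"
  by (simp add: plus_free_group.abs_eq)

lemma abs_free_group_word_inv: "abs_free_group (word_inv u) = - abs_free_group u"
  by (simp add: uminus_free_group.abs_eq)

lemma abs_free_group_Nil: "abs_free_group [] = 0"
  by (simp add: zero_free_group.abs_eq)

text \<open>Pairs are removed at the junction, one at a time; once the two letters that meet there
  are not inverse, the concatenation is reduced.\<close>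

lemma reduced_cancellation:
  assumes "reduced u" "reduced v"
  shows "\<exists>a s b. u = a @ s \<and> v = word_inv s @ b \<and> reduced (a @ b)"
  using assms
proof (induction u arbitrary: v rule: rev_induct)
  case Nil
  then show ?case by (metis append_Nil word_inv_simps(1))
next
  case (snoc l u)
  show ?case
  proof (cases "v \<noteq> [] \<and> hd v = linv l")
    case False
    then have "reduced ((u @ [l]) @ v)"
      using snoc.prems by (cases v) (auto simp: successively_append_iff successively_Cons)
    then show ?thesis by (intro exI[of _ "u @ [l]"] exI[of _ "[]"] exI[of _ v]) simp
  next
    case True
    then have v: "v = linv l # tl v" by (metis list.collapse)
    then have "reduced (tl v)" using snoc.prems(2) by (metis successively_Cons successively.simps(1))
    moreover have "reduced u" using snoc.prems(1) by (simp add: successively_append_iff)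
    ultimately obtain a s b where "u = a @ s" "tl v = word_inv s @ b" "reduced (a @ b)"
      using snoc.IH by blast
    with v show ?thesis
      by (intro exI[of _ a] exI[of _ "s @ [l]"] exI[of _ b]) simp
  qed
qed

section \<open>Length and cancellation in products\<close>

abbreviation flen :: "'a free_group \<Rightarrow> nat" where
  "flen x \<equiv> length (rword x)"

text \<open>The number of pairs of letters that cancel in the product. Truncated subtraction and
  halving lose nothing here, by \<open>flen_plus\<close>.\<close>

definition canc :: "'a free_group \<Rightarrow> 'a free_group \<Rightarrow> nat" where
  "canc x y = (flen x + flen y - flen (x + y)) div 2"

lemma rword_plus:
  obtains a s b where "rword x = a @ s" "rword y = word_inv s @ b" "rword (x + y) = a @ b"
    "length s = canc x y"
proof -
  obtain a s b where *: "rword x = a @ s" "rword y = word_inv s @ b" "reduced (a @ b)"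
    using reduced_cancellation[OF reduced_rword reduced_rword] by blast
  have "x + y = abs_free_group (a @ s) + abs_free_group (word_inv s @ b)"
    by (metis *(1,2) abs_rword)
  also have "\<dots> = abs_free_group (a @ b)"
    by (simp add: abs_free_group_append abs_free_group_word_inv add.assoc
        flip: add.assoc[of "abs_free_group s"])
  finally have "rword (x + y) = a @ b" using * by (simp add: rword_abs)
  with * show ?thesis by (intro that[of a s b]) (auto simp: canc_def)
qed

lemma flen_plus: "flen (x + y) + 2 * canc x y = flen x + flen y"
  by (rule rword_plus[of x y]) auto

lemma flen_uminus [simp]: "flen (- x) = flen x"
  by (simp add: rword_uminus)

lemma canc_uminus: "canc (- y) (- x) = canc x y"
proof -
  have "flen (- y + - x) = flen (x + y)" by (metis flen_uminus minus_add)
  then show ?thesis by (simp add: canc_def add.commute)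
qed

lemma rword_plus_if:
  assumes "rword x = a @ s" "rword y = word_inv s @ b" "length s = canc x y"
  shows "rword (x + y) = a @ b"
proof (rule rword_plus[of x y])
  fix a' s' b'
  assume "rword x = a' @ s'" "rword y = word_inv s' @ b'" "rword (x + y) = a' @ b'"
    "length s' = canc x y"
  with assms show ?thesis by (metis append_eq_append_conv same_append_eq append_same_eq)
qed

text \<open>A word cancelling half of itself would have a self-inverse middle letter or be trivial.\<close>

lemma canc_self:
  assumes "x \<noteq> 0"
  shows "2 * canc x x < flen x"
proof (rule ccontr)
  assume *: "\<not> ?thesis"
  obtain a s b where w: "rword x = a @ s" "rword x = word_inv s @ b" "length s = canc x x"
    by (rule rword_plus)
  let ?n = "flen x" and ?c = "length s"
  have nz: "?n > 0" using assms by simp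
  have c: "?c \<le> ?n" "?n \<le> 2 * ?c" using w * by auto
  \<comment> \<open>The cancelled suffix and the cancelled prefix lie in the same word, so
    reflection about its centre inverts letters; by assumption the cancelled part reaches the
    centre.\<close>
  have mirror: "rword x ! (?n - 1 - i) = linv (rword x ! i)" if "i < ?c" for i
  proof -
    have "rword x ! i = linv (s ! (?c - Suc i))"
      using that w(2) by (simp add: nth_append word_inv_linv rev_nth)
    moreover have "rword x ! (?n - 1 - i) = s ! (?c - Suc i)"
      using that w(1) c by (auto simp: nth_append intro!: arg_cong[of _ _ "(!) s"])
    ultimately show ?thesis by simp
  qed
  show False
  proof (cases "even ?n")
    case False
    then have "?n - 1 - ?n div 2 = ?n div 2" "?n div 2 < ?c" using c by presburger+
    then show False using mirror[of "?n div 2"] by simp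
  next
    case True
    then have i: "?n - 1 - (?n div 2 - 1) = Suc (?n div 2 - 1)" "?n div 2 - 1 < ?c"
      "Suc (?n div 2 - 1) < ?n"
      using c nz by presburger+
    then have "rword x ! Suc (?n div 2 - 1) = linv (rword x ! (?n div 2 - 1))"
      using mirror[of "?n div 2 - 1"] by simp
    moreover have "rword x ! Suc (?n div 2 - 1) \<noteq> linv (rword x ! (?n div 2 - 1))"
      using reduced_rword[of x] i(3) unfolding successively_conv_nth by blast
    ultimately show False by simp
  qed
qed

section \<open>Nielsen reduced families\<close>

text \<open>By \<open>core\<close>, every factor keeps a letter between the parts lost to its two
  neighbours. So the induction can carry a tail \<open>t\<close> of the last factor, trimmed only on
  its left, behind a prefix \<open>Z\<close> that has gained a letter for each earlier
  factor.\<close>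

lemma nielsen_reduced_product:
  fixes z :: "'a \<times> bool \<Rightarrow> 'b free_group"
  assumes core: "\<And>l1 l2 l3. l2 \<noteq> linv l1 \<Longrightarrow> l3 \<noteq> linv l2 \<Longrightarrow>
      canc (z l1) (z l2) + canc (z l2) (z l3) < flen (z l2)"
    and short: "\<And>l l'. l' \<noteq> linv l \<Longrightarrow> canc (z l) (z l') < flen (z l)"
    and "reduced (w @ [l])"
  shows "\<exists>Z t t'. rword (sum_list (map z (w @ [l]))) = Z @ t \<and> length w \<le> length Z \<and>
    rword (z l) = t' @ t \<and> length t' = (if w = [] then 0 else canc (z (last w)) (z l))"
  using assms(3)
proof (induction w arbitrary: l rule: rev_induct)
  case Nil
  show ?case by (rule exI[of _ "[]"]) simp
next
  case (snoc l0 w)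
  let ?y = "sum_list (map z (w @ [l0]))"
  have red: "reduced (w @ [l0])" and l: "l \<noteq> linv l0"
    using snoc.prems by (auto simp: successively_append_iff)
  obtain Z t t' where IH: "rword ?y = Z @ t" "length w \<le> length Z" "rword (z l0) = t' @ t"
      "length t' = (if w = [] then 0 else canc (z (last w)) (z l0))"
    using snoc.IH[OF red] by blast
  obtain a s b where s: "rword (z l0) = a @ s" "rword (z l) = word_inv s @ b"
      "rword (z l0 + z l) = a @ b" "length s = canc (z l0) (z l)"
    by (rule rword_plus)
  \<comment> \<open>The loss \<open>t'\<close> on the left and the new loss \<open>s\<close> on the
    right do not meet inside \<open>z l0\<close>; the letters between them form the nonempty
    \<open>r\<close> below.\<close>
  have "length t' + length s < flen (z l0)"
  proof (cases "w = []")
    case True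
    then show ?thesis using IH(4) s(4) short[OF l] by simp
  next
    case False
    then have "l0 \<noteq> linv (last w)" using red by (auto simp: successively_append_iff)
    then show ?thesis using IH(4) s(4) core[of l0 "last w" l] l False by simp
  qed
  then have "length s < length t" using IH(3) by simp
  moreover have "t' @ t = a @ s" using IH(3) s(1) by simp
  then obtain r where "t' = a @ r \<and> r @ t = s \<or> t' @ r = a \<and> t = r @ s"
    unfolding append_eq_append_conv2 by blast
  ultimately have r: "t = r @ s" "a = t' @ r" "r \<noteq> []" by auto
  have "reduced ((Z @ r) @ s)" by (metis IH(1) r(1) reduced_rword append.assoc)
  then have "reduced (Z @ r)" by (simp only: successively_append_iff[of _ "Z @ r" s])
  moreover have "reduced (t' @ r @ b)" by (metis s(3) r(2) reduced_rword append.assoc)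
  then have "reduced (r @ b)" by (simp only: successively_append_iff[of _ "t'" "r @ b"])
  \<comment> \<open>The two reduced words \<open>Z @ r\<close> and \<open>r @ b\<close> overlap in
    the nonempty \<open>r\<close>, so gluing them creates no adjacent inverse letters.\<close>
  ultimately have red': "reduced ((Z @ r) @ b)"
    using r(3) by (simp add: successively_append_iff)
  have "?y + z l = abs_free_group ((Z @ r) @ s) + abs_free_group (word_inv s @ b)"
    by (metis IH(1) r(1) s(2) abs_rword append.assoc)
  also have "\<dots> = abs_free_group ((Z @ r) @ b)"
    by (simp add: abs_free_group_append abs_free_group_word_inv add.assoc
        flip: add.assoc[of "abs_free_group s"])
  finally have "rword (sum_list (map z ((w @ [l0]) @ [l]))) = (Z @ r) @ b"
    using rword_abs[OF red'] by (simp add: add.assoc)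
  moreover have "length (w @ [l0]) \<le> length (Z @ r)"
    using IH(2) r(3) by (cases r) auto
  ultimately show ?case
    using s(2,4) by (intro exI[of _ "Z @ r"] exI[of _ b] exI[of _ "word_inv s"]) simp
qed

lemma nielsen_reduced_length:
  fixes z :: "'a \<times> bool \<Rightarrow> 'b free_group"
  assumes core: "\<And>l1 l2 l3. l2 \<noteq> linv l1 \<Longrightarrow> l3 \<noteq> linv l2 \<Longrightarrow>
      canc (z l1) (z l2) + canc (z l2) (z l3) < flen (z l2)"
    and short: "\<And>l l'. l' \<noteq> linv l \<Longrightarrow> canc (z l) (z l') < flen (z l)"
    and short': "\<And>l l'. l' \<noteq> linv l \<Longrightarrow> canc (z l) (z l') < flen (z l')"
    and "reduced w"
  shows "length w \<le> flen (sum_list (map z w))"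
proof (cases w rule: rev_cases)
  case (snoc w0 l)
  then have red: "reduced (w0 @ [l])" using assms(4) by simp
  obtain Z t t' where Z: "rword (sum_list (map z w)) = Z @ t" "length w0 \<le> length Z"
    "rword (z l) = t' @ t" "length t' = (if w0 = [] then 0 else canc (z (last w0)) (z l))"
    using nielsen_reduced_product[of z w0 l, OF core short red] unfolding snoc by blast
  have "length t' < flen (z l)"
  proof (cases "w0 = []")
    case True
    \<comment> \<open>For a single factor only nonemptiness of \<open>z l\<close> is wanted; the
      strict bound for the pair \<open>l\<close>, \<open>l\<close> supplies it.\<close>
    then show ?thesis using Z(4) short'[of l l] by (simp del: length_greater_0_conv)
  next
    case False
    then have "l \<noteq> linv (last w0)" using red by (auto simp: successively_append_iff)
    then show ?thesis using False Z(4) short' by simp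
  qed
  then have "t \<noteq> []" using Z(3) by auto
  then show ?thesis using Z(1,2) snoc by (cases t) auto
qed simp


section \<open>Automorphisms given by the images of the basis\<close>

lift_definition fhom :: "('a \<Rightarrow> 'b::group_add) \<Rightarrow> 'a free_group \<Rightarrow> 'b" is
  "\<lambda>g u. sum_list (map (\<lambda>(a, e). if e then g a else - g a) u)"
proof -
  fix g :: "'a \<Rightarrow> 'b" and u v :: "('a \<times> bool) list"
  assume "word_eq u v"
  then show "sum_list (map (\<lambda>(a, e). if e then g a else - g a) u) =
      sum_list (map (\<lambda>(a, e). if e then g a else - g a) v)"
    by induction (auto simp flip: add.assoc)
qed

lemma fhom_gen [simp]: "fhom g (fgen a) = g a"
  by transfer simp

lemma fhom_zero [simp]: "fhom g 0 = 0"
  by transfer simp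

lemma fhom_add [simp]: "fhom g (x + y) = fhom g x + fhom g y"
  by transfer simp

lemma hom_zero:
  fixes h :: "'a::group_add \<Rightarrow> 'b::group_add"
  assumes "\<And>x y. h (x + y) = h x + h y"
  shows "h 0 = 0"
  using assms[of 0 0] by (metis add.right_neutral add_left_cancel)

lemma hom_uminus:
  fixes h :: "'a::group_add \<Rightarrow> 'b::group_add"
  assumes "\<And>x y. h (x + y) = h x + h y"
  shows "h (- x) = - h x"
  using assms[of "- x" x] hom_zero[of h, OF assms] by (simp add: eq_neg_iff_add_eq_0)

lemma fhom_uminus [simp]: "fhom g (- x) = - fhom g x"
  by (rule hom_uminus) simp

lemma fhom_diff [simp]: "fhom g (x - y) = fhom g x - fhom g y"
  by (simp only: diff_conv_add_uminus fhom_add fhom_uminus)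

lemma free_group_hom_eqI:
  fixes h k :: "'a free_group \<Rightarrow> 'b::group_add"
  assumes "\<And>x y. h (x + y) = h x + h y" "\<And>x y. k (x + y) = k x + k y"
    "\<And>a. h (fgen a) = k (fgen a)"
  shows "h x = k x"
  by (induction x rule: free_group_induct)
    (simp_all add: assms hom_zero[of h, OF assms(1)] hom_zero[of k, OF assms(2)]
      hom_uminus[of h, OF assms(1)] hom_uminus[of k, OF assms(2)])

lemmas ract_zero [simp] = hom_zero[of "ract s" for s, OF ract_add]
lemmas ract_uminus [simp] = hom_uminus[of "ract s" for s, OF ract_add]
declare ract_add [simp]

lemma ract_diff [simp]: "ract s (x - y) = ract s x - ract s y"
  by (simp only: diff_conv_add_uminus ract_add ract_uminus)

lemma ract_times [simp]: "ract (s * t) x = ract t (ract s x)"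
  by transfer simp

lemma ract_one [simp]: "ract 1 x = x"
  by transfer simp

lemma ract_inverse [simp]: "ract (inverse s) (ract s x) = x" "ract s (ract (inverse s) x) = x"
  by (metis aut_inverse ract_one ract_times)+

lemma ract_inject [simp]: "ract s x = ract s y \<longleftrightarrow> x = y"
  by (metis ract_inverse(1))

lemma ract_eq_zero [simp]: "ract s x = 0 \<longleftrightarrow> x = 0"
  by (metis ract_inject ract_zero)

lemma aut_eqI:
  assumes "\<And>a. ract s (fgen a) = ract t (fgen a)"
  shows "s = t"
proof -
  have "ract s x = ract t x" for x
    by (rule free_group_hom_eqI) (simp_all add: assms)
  then show ?thesis by (metis ext ract_inject[THEN iffD1] aut.ract_inject)
qed

text \<open>\<open>Abs_aut\<close> is meaningful only if \<open>fhom g\<close> is bijective;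
  \<open>ract_aut_of\<close> secures this in each case from an inverse family
  \<open>h\<close>.\<close>

definition aut_of :: "('n \<Rightarrow> 'n free_group) \<Rightarrow> 'n aut" where
  "aut_of g = Abs_aut (fhom g)"

lemma ract_aut_of:
  assumes "\<And>a. fhom h (g a) = fgen a" "\<And>a. fhom g (h a) = fgen a"
  shows "ract (aut_of g) = fhom g"
proof -
  have "fhom h (fhom g x) = x" "fhom g (fhom h x) = x" for x
    by (rule free_group_hom_eqI; simp add: assms)+
  then have "bij (fhom g)" by (intro o_bij[of "fhom h"]) auto
  then show ?thesis by (simp add: aut_of_def Abs_aut_inverse)
qed

section \<open>Signed permutations and transvections\<close>

definition perm_aut :: "('n \<Rightarrow> 'n) \<Rightarrow> 'n aut" where
  "perm_aut \<pi> = aut_of (\<lambda>a. fgen (\<pi> a))"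

definition sign_aut :: "'n set \<Rightarrow> 'n aut" where
  "sign_aut S = aut_of (\<lambda>a. if a \<in> S then - fgen a else fgen a)"

definition transvection :: "'n \<Rightarrow> 'n \<Rightarrow> 'n aut" where
  "transvection p q = aut_of (\<lambda>a. if a = p then fgen p + fgen q else fgen a)"

lemma ract_perm_aut [simp]: "bij \<pi> \<Longrightarrow> ract (perm_aut \<pi>) (fgen a) = fgen (\<pi> a)"
  unfolding perm_aut_def
  by (subst ract_aut_of[of "\<lambda>a. fgen (inv \<pi> a)"])
    (auto simp: bij_def surj_f_inv_f)

lemma ract_sign_aut [simp]:
  "ract (sign_aut S) (fgen a) = (if a \<in> S then - fgen a else fgen a)"
  unfolding sign_aut_def
  by (subst ract_aut_of[of "\<lambda>a. if a \<in> S then - fgen a else fgen a"]) auto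

lemma ract_transvection [simp]:
  "p \<noteq> q \<Longrightarrow> ract (transvection p q) (fgen a) = (if a = p then fgen p + fgen q else fgen a)"
  unfolding transvection_def
  by (subst ract_aut_of[of "\<lambda>a. if a = p then fgen p - fgen q else fgen a"])
    (auto simp: add.assoc)

lemma sign_aut_inverse [simp]: "inverse (sign_aut S) = sign_aut S"
proof -
  have "sign_aut S * sign_aut S = 1" by (rule aut_eqI) simp
  then show ?thesis by (metis aut_inverse(1) mult.assoc mult.left_neutral mult.right_neutral)
qed

lemma perm_aut_inverse: "bij \<pi> \<Longrightarrow> inverse (perm_aut \<pi>) = perm_aut (inv \<pi>)"
proof -
  assume \<pi>: "bij \<pi>"
  then have "perm_aut \<pi> * perm_aut (inv \<pi>) = 1"
    by (intro aut_eqI) (simp add: bij_imp_bij_inv bij_is_inj)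
  then show ?thesis by (metis aut_inverse(1) mult.assoc mult.left_neutral mult.right_neutral)
qed

lemma ract_inverse_transvection [simp]:
  assumes "p \<noteq> q"
  shows "ract (inverse (transvection p q)) (fgen a) =
    (if a = p then fgen p - fgen q else fgen a)"
proof -
  have "fgen a = ract (transvection p q) (if a = p then fgen p - fgen q else fgen a)"
    using assms by (simp add: add.assoc)
  then show ?thesis by (metis ract_inverse(1))
qed

section \<open>Nielsen's theorem\<close>

inductive_set nielsen :: "'n \<Rightarrow> 'n \<Rightarrow> 'n aut set" for p q where
  perm: "bij \<pi> \<Longrightarrow> perm_aut \<pi> \<in> nielsen p q"
| sign: "sign_aut S \<in> nielsen p q"
| transv: "transvection p q \<in> nielsen p q"
| mult: "s \<in> nielsen p q \<Longrightarrow> t \<in> nielsen p q \<Longrightarrow> s * t \<in> nielsen p q"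
| inverse: "s \<in> nielsen p q \<Longrightarrow> inverse s \<in> nielsen p q"

lemma inverse_inverse_aut [simp]: "inverse (inverse (s :: 'n aut)) = s"
  by (metis aut_inverse mult.assoc mult.left_neutral mult.right_neutral)

lemma inverse_times_aut: "inverse (s * t) = inverse t * inverse (s :: 'n aut)"
proof -
  have "(s * t) * (inverse t * inverse s) = s * (t * inverse t) * inverse s"
    by (simp only: mult.assoc)
  then have "(s * t) * (inverse t * inverse s) = 1" by (simp add: aut_inverse)
  then show ?thesis by (metis aut_inverse(1) mult.assoc mult.left_neutral mult.right_neutral)
qed

lemma ex_bij_pair:
  assumes "p \<noteq> q" "a \<noteq> b"
  obtains \<pi> :: "'n \<Rightarrow> 'n" where "bij \<pi>" "\<pi> a = p" "\<pi> b = q"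
proof -
  define b' where "b' = Transposition.transpose a p b"
  \<comment> \<open>\<open>b'\<close> is where the first swap sends \<open>b\<close>. As it differs
    from \<open>p\<close>, the second swap preserves the value already arranged at
    \<open>a\<close>.\<close>
  have "b' \<noteq> p" using assms(2)
    by (metis b'_def transpose_apply_first transpose_involutory)
  let ?\<pi> = "Transposition.transpose b' q \<circ> Transposition.transpose a p"
  have "bij ?\<pi>" by (intro bij_comp bij_transpose)
  moreover have "?\<pi> a = p" "?\<pi> b = q"
    using \<open>b' \<noteq> p\<close> assms(1) by (auto simp: transpose_apply_other simp flip: b'_def)
  ultimately show ?thesis by (rule that)
qed

lemma transvection_conj:
  assumes "bij \<pi>" "a \<noteq> b"
  shows "transvection a b = perm_aut \<pi> * transvection (\<pi> a) (\<pi> b) * inverse (perm_aut \<pi>)"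
proof (rule aut_eqI)
  fix c
  have inj: "\<pi> x = \<pi> y \<longleftrightarrow> x = y" for x y
    using assms(1) by (auto dest: bij_is_inj injD)
  have "ract (inverse (perm_aut \<pi>)) (fgen (\<pi> x)) = fgen x" for x
    using assms(1) by (simp add: perm_aut_inverse bij_imp_bij_inv bij_is_inj)
  then show "ract (transvection a b) (fgen c) =
      ract (perm_aut \<pi> * transvection (\<pi> a) (\<pi> b) * inverse (perm_aut \<pi>)) (fgen c)"
    using assms by (simp add: inj)
qed

lemma transvection_in_nielsen:
  assumes "p \<noteq> q" "a \<noteq> b"
  shows "transvection a b \<in> nielsen p q"
proof -
  obtain \<pi> where "bij \<pi>" "\<pi> a = p" "\<pi> b = q" using ex_bij_pair[OF assms] .
  then show ?thesis
    using transvection_conj[of \<pi> a b] assms by (simp add: nielsen.intros)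
qed

lemma nielsen_move:
  assumes "p \<noteq> q" "fst l \<noteq> fst l'"
  obtains \<nu> where "\<nu> \<in> nielsen p q" "ract \<nu> (fletter l) = fletter l + fletter l'"
    "\<And>k. fst k \<noteq> fst l \<Longrightarrow> ract \<nu> (fletter k) = fletter k"
proof -
  let ?i = "fst l" and ?j = "fst l'"
  define t where "t = (if snd l' then transvection ?i ?j else inverse (transvection ?i ?j))"
  \<comment> \<open>Conjugation by the sign change at \<open>?i\<close> turns right multiplication
    of x_i into right multiplication of its inverse.\<close>
  define \<nu> where "\<nu> = (if snd l then t else sign_aut {?i} * t * sign_aut {?i})"
  have "t \<in> nielsen p q"
    using transvection_in_nielsen[OF assms] by (simp add: t_def nielsen.inverse)
  then have "\<nu> \<in> nielsen p q" by (simp add: \<nu>_def nielsen.intros)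
  moreover have t: "ract t (fgen k) = (if k = ?i then fgen k + fletter l' else fgen k)" for k
    using assms(2) by (simp add: t_def fletter_if)
  have "ract \<nu> (fletter l) = fletter l + fletter l'"
    using assms(2) by (auto simp: \<nu>_def fletter_if t minus_add)
  moreover have "ract \<nu> (fletter k) = fletter k" if "fst k \<noteq> ?i" for k
    using that by (auto simp: \<nu>_def fletter_if t)
  ultimately show ?thesis by (rule that)
qed

text \<open>
  Ties between equally long families are broken by the left halves of the words, read as
  numbers in base \<open>CARD('a \<times> bool)\<close>.
\<close>

definition left_half :: "'a list \<Rightarrow> 'a list" where
  "left_half u = take ((length u + 1) div 2) u"

primrec word_value :: "'a::finite list \<Rightarrow> nat" where
  "word_value [] = 0"
| "word_value (l # u) = to_nat_on UNIV l * CARD('a) ^ length u + word_value u"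

lemma to_nat_on_less: "to_nat_on UNIV (l :: 'a::finite) < CARD('a)"
  using to_nat_on_finite[of "UNIV :: 'a set"] by (auto simp: bij_betw_def)

lemma word_value_less: "word_value (u :: 'a::finite list) < CARD('a) ^ length u"
proof (induction u)
  case (Cons l u)
  let ?n = "CARD('a) ^ length u"
  have "to_nat_on UNIV l * ?n + ?n \<le> CARD('a) * ?n"
    using to_nat_on_less[of l] by (metis Suc_leI add.commute mult_Suc mult_le_mono1)
  then show ?case using Cons by simp
qed simp

lemma word_value_append:
  "word_value (u @ v :: 'a::finite list) = word_value u * CARD('a) ^ length v + word_value v"
  by (induction u) (simp_all add: algebra_simps power_add)

lemma word_value_inject:
  "length u = length v \<Longrightarrow> word_value u = word_value v \<Longrightarrow> u = (v :: 'a::finite list)"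
proof (induction u v rule: list_induct2)
  case (Cons l u m v)
  let ?n = "CARD('a) ^ length u"
  have *: "to_nat_on UNIV l * ?n + word_value u = to_nat_on UNIV m * ?n + word_value v"
    using Cons.prems Cons.hyps by simp
  have lt: "word_value u < ?n" "word_value v < ?n"
    using word_value_less[of u] word_value_less[of v] Cons.hyps by simp_all
  have "to_nat_on UNIV l = (to_nat_on UNIV l * ?n + word_value u) div ?n"
    "to_nat_on UNIV m = (to_nat_on UNIV m * ?n + word_value v) div ?n"
    using lt by simp_all
  then have "to_nat_on UNIV l = to_nat_on UNIV m" using * by metis
  moreover then have "word_value u = word_value v" using * by simp
  ultimately show ?case
    using Cons.IH by (simp add: countable_finite)
qed simp

text \<open>The sum runs over letters of both signs, so each image is weighed together with its
  inverse; left halves then register both ends of every word.\<close>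

definition weight :: "(('n::finite \<times> bool) list \<Rightarrow> nat) \<Rightarrow> 'n aut \<Rightarrow> nat" where
  "weight \<phi> s = (\<Sum>l\<in>UNIV. \<phi> (rword (ract s (fletter l))))"

lemma weight_split:
  "weight \<phi> s = \<phi> (rword (ract s (fletter l))) + \<phi> (rword (- ract s (fletter l))) +
    (\<Sum>k | fst k \<noteq> fst l. \<phi> (rword (ract s (fletter k))))"
proof -
  have U: "UNIV = insert l (insert (linv l) {k. fst k \<noteq> fst l})"
    by (auto simp: linv_def prod_eq_iff)
  show ?thesis
    unfolding weight_def by (subst U) (simp add: fletter_linv)
qed

text \<open>In \<open>\<nu> * s\<close> the move comes first, so \<open>s\<close> turns it into a
  multiplication of images that affects only \<open>l\<close> and \<open>linv l\<close>. The
  additive form avoids subtraction of naturals.\<close>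

lemma weight_move:
  assumes "\<And>k. fst k \<noteq> fst l \<Longrightarrow> ract \<nu> (fletter k) = fletter k"
    "ract \<nu> (fletter l) = fletter l + fletter l'"
  shows "weight \<phi> (\<nu> * s) + \<phi> (rword (ract s (fletter l))) + \<phi> (rword (- ract s (fletter l))) =
    weight \<phi> s + \<phi> (rword (ract s (fletter l) + ract s (fletter l'))) +
      \<phi> (rword (- (ract s (fletter l) + ract s (fletter l'))))"
  using assms by (simp add: weight_split[of _ _ l])

lemma signed_perm_in_nielsen:
  assumes "\<And>i. \<exists>l. ract s (fgen i) = fletter l"
  shows "(s :: 'n::finite aut) \<in> nielsen p q"
proof -
  obtain l where l: "\<And>i. ract s (fgen i) = fletter (l i)" using assms by metis
  define \<pi> where "\<pi> = (\<lambda>i. fst (l i))"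
  have "inj \<pi>"
  proof (rule injI)
    fix i j
    assume "\<pi> i = \<pi> j"
    then have "l i = l j \<or> l i = linv (l j)" by (auto simp: \<pi>_def linv_def prod_eq_iff)
    then have "ract s (fgen i) = ract s (fgen j) \<or> ract s (fgen i) = ract s (- fgen j)"
      by (auto simp: l fletter_linv)
    then have "fgen i = fgen j \<or> fgen i = fletter (j, False)"
      by (simp only: ract_inject fletter_simps)
    then show "i = j" using fletter_inject[of "(i, True)" "(j, False)"] by (simp add: fletter_simps)
  qed
  then have \<pi>: "bij \<pi>" by (simp add: bij_def finite_UNIV_inj_surj)
  have "s = sign_aut {i. \<not> snd (l i)} * perm_aut \<pi>"
    using \<pi> by (intro aut_eqI) (auto simp: l fletter_if \<pi>_def)
  then show ?thesis using \<pi> by (simp add: nielsen.intros)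
qed

text \<open>Since \<open>u\<close> and \<open>v\<close> have the same length, replacing the image
  \<open>v @ c\<close> by \<open>u @ c\<close> preserves all lengths but lowers its left
  half.\<close>

lemma nielsen_tie_step:
  fixes s :: "'n::finite aut"
  defines "z \<equiv> \<lambda>l. ract s (fletter l)"
  assumes "p \<noteq> q" "fst l \<noteq> fst l'"
    and u: "rword (z l) = u @ word_inv v" "rword (z l') = v @ c"
    and len: "length u = length v" "length v = canc (z l) (z l')" "length v \<le> length c"
    and less: "word_value u < word_value v"
  shows "\<exists>\<nu>\<in>nielsen p q. weight length (\<nu> * s) = weight length s \<and>
    weight (word_value \<circ> left_half) (\<nu> * s) < weight (word_value \<circ> left_half) s"
proof -
  \<comment> \<open>Moves multiply on the right, whereas \<open>z l'\<close> is to be multiplied by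
    \<open>z l\<close> on the left; so the move is made on the inverse letters.\<close>
  have *: "fst (linv l') \<noteq> fst (linv l)" using assms(3) by simp
  obtain \<nu> where \<nu>: "\<nu> \<in> nielsen p q"
    "ract \<nu> (fletter (linv l')) = fletter (linv l') + fletter (linv l)"
    "\<And>k. fst k \<noteq> fst (linv l') \<Longrightarrow> ract \<nu> (fletter k) = fletter k"
    using nielsen_move[OF \<open>p \<noteq> q\<close> *] by metis
  have sum: "- z l' + ract s (fletter (linv l)) = - (z l + z l')"
    by (simp add: z_def fletter_linv minus_add)
  have neg: "ract s (fletter (linv l')) = - z l'" by (simp add: z_def fletter_linv)
  have uc: "rword (z l + z l') = u @ c"
    using rword_plus_if[of "z l" u "word_inv v" "z l'" c] u len by simp
  note move = weight_move[OF \<nu>(3,2), of _ s, unfolded sum neg minus_minus rword_uminus uc u(2)]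
  have "weight length (\<nu> * s) = weight length s"
    using move[of length] len(1) by simp
  \<comment> \<open>As \<open>v\<close> is no longer than \<open>c\<close>, the left half contains
    the whole prefix \<open>u\<close> or \<open>v\<close>. For the inverse words it stays inside the
    inverse of \<open>c\<close>, even after rounding up, and does not change.\<close>
  moreover have "word_value (left_half (u @ c)) < word_value (left_half (v @ c))"
    using less len(1,3) by (simp add: left_half_def word_value_append)
  moreover have "left_half (word_inv (u @ c)) = left_half (word_inv (v @ c))"
    using len(1,3) by (simp add: left_half_def)
  ultimately have "weight length (\<nu> * s) = weight length s"
    "weight (word_value \<circ> left_half) (\<nu> * s) < weight (word_value \<circ> left_half) s"
    using move[of "word_value \<circ> left_half"] by simp_all
  then show ?thesis using \<nu>(1) by auto
qed

theorem nielsen_generates: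
  assumes "p \<noteq> q"
  shows "(s :: 'n::finite aut) \<in> nielsen p q"
proof (induction "(weight length s, weight (word_value \<circ> left_half) s)" arbitrary: s
    rule: wf_induct_rule[OF wf_lex_prod[OF wf_less wf_less]])
  case (1 s)
  show ?case
  proof (cases "\<exists>\<nu>\<in>nielsen p q. weight length (\<nu> * s) < weight length s \<or>
      weight length (\<nu> * s) = weight length s \<and>
        weight (word_value \<circ> left_half) (\<nu> * s) < weight (word_value \<circ> left_half) s")
    case True
    then obtain \<nu> where \<nu>: "\<nu> \<in> nielsen p q" "\<nu> * s \<in> nielsen p q"
      using 1 by (auto simp: lex_prod_def)
    have "s = inverse \<nu> * (\<nu> * s)" by (simp add: aut_inverse flip: mult.assoc)
    then show ?thesis using \<nu> by (metis nielsen.intros(4,5))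
  next
    case False
    then have minimal: "weight length s \<le> weight length (\<nu> * s)"
        "weight length (\<nu> * s) = weight length s \<Longrightarrow>
          weight (word_value \<circ> left_half) s \<le> weight (word_value \<circ> left_half) (\<nu> * s)"
      if "\<nu> \<in> nielsen p q" for \<nu>
      using that by (meson linorder_not_le)+
    define z where "z = (\<lambda>l. ract s (fletter l))"
    have nz: "z l \<noteq> 0" for l
      by (simp add: z_def)
    have zinv: "z (linv l) = - z l" for l
      by (simp add: z_def fletter_linv)
    \<comment> \<open>Otherwise the move from \<open>z l\<close> to \<open>z l + z l'\<close> would
      lower the total length.\<close>
    have short: "flen (z l) \<le> flen (z l + z l')" if ne: "fst l \<noteq> fst l'" for l l'
    proof -
      obtain \<nu> where \<nu>: "\<nu> \<in> nielsen p q" "ract \<nu> (fletter l) = fletter l + fletter l'"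
        "\<And>k. fst k \<noteq> fst l \<Longrightarrow> ract \<nu> (fletter k) = fletter k"
        using nielsen_move[OF assms ne] by metis
      show ?thesis
        using minimal(1)[OF \<nu>(1)] weight_move[OF \<nu>(3,2), of length s] by (simp add: z_def)
    qed
    \<comment> \<open>If a product is no shorter than either factor, at most half of each cancels.
      No move produces the square of a letter; that case is \<open>canc_self\<close>.\<close>
    have half: "2 * canc (z l) (z l') \<le> flen (z l) \<and> 2 * canc (z l) (z l') \<le> flen (z l')"
      if ne: "l' \<noteq> linv l" for l l'
    proof (cases "fst l = fst l'")
      case True
      then have "l' = l" using ne by (auto simp: linv_def prod_eq_iff)
      then show ?thesis using canc_self[OF nz[of l]] by simp
    next
      case False
      have "flen (- z l' + - z l) = flen (z l + z l')" by (metis flen_uminus minus_add)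
      then show ?thesis
        using short[of l l'] short[of "linv l'" "linv l"] False flen_plus[of "z l" "z l'"]
        by (simp add: zinv)
    qed
    have pos: "0 < flen (z l)" for l using nz by simp
    have strict: "canc (z l) (z l') < flen (z l) \<and> canc (z l) (z l') < flen (z l')"
      if "l' \<noteq> linv l" for l l'
      using half[OF that] pos[of l] pos[of l'] by linarith
    have no_tie: False
      if h: "fst l \<noteq> fst l'" "rword (z l) = u @ word_inv v" "rword (z l') = v @ c"
        "length u = length v" "length v = canc (z l) (z l')" "length v \<le> length c"
        "word_value u < word_value v" for l l' u v c
      using nielsen_tie_step[OF assms h(1) h(2-7)[unfolded z_def]] False
      by blast
    \<comment> \<open>By \<open>half\<close> the only possible failure is that both neighbours
      consume exactly half of \<open>z l2\<close>, whose word is then \<open>u @ word_inv v\<close>.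
      The order between \<open>u\<close> and \<open>v\<close> yields a move that breaks the
      tie.\<close>
    have core: "canc (z l1) (z l2) + canc (z l2) (z l3) < flen (z l2)"
      if l: "l2 \<noteq> linv l1" "l3 \<noteq> linv l2" for l1 l2 l3
    proof (rule ccontr)
      assume "\<not> ?thesis"
      then have eq: "2 * canc (z l1) (z l2) = flen (z l2)" "2 * canc (z l2) (z l3) = flen (z l2)"
        using half[OF l(1)] half[OF l(2)] by linarith+
      have "l1 \<noteq> l2" "l2 \<noteq> l3" using canc_self[OF nz] eq by (metis less_irrefl)+
      then have ne: "fst l1 \<noteq> fst l2" "fst l2 \<noteq> fst l3"
        using l by (auto simp: linv_def prod_eq_iff)
      obtain a u' b where 1: "rword (z l1) = a @ u'" "rword (z l2) = word_inv u' @ b"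
          "length u' = canc (z l1) (z l2)"
        by (rule rword_plus)
      obtain d v' c where 2: "rword (z l2) = d @ v'" "rword (z l3) = word_inv v' @ c"
          "length v' = canc (z l2) (z l3)"
        by (rule rword_plus)
      have d: "d = word_inv u'" "b = v'" using 1 2 eq by (auto simp: append_eq_append_conv)
      define u v where "u = word_inv u'" and "v = word_inv v'"
      have w: "rword (z l1) = a @ word_inv u" "rword (z l2) = u @ word_inv v"
          "rword (z l3) = v @ c" and len: "length u = length v"
          "length v = canc (z l2) (z l3)" "length u = canc (z l1) (z l2)"
        using 1 2 d eq by (simp_all add: u_def v_def)
      have "u \<noteq> v"
      proof
        assume "u = v"
        then have "z l2 = 0"
          by (metis w(2) abs_rword abs_free_group_append abs_free_group_word_inv add.right_inverse)
        then show False using nz by simp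
      qed
      then consider "word_value u < word_value v" | "word_value v < word_value u"
        using word_value_inject[OF len(1)] by linarith
      then show False
      proof cases
        case 1
        have "length v \<le> length c" using half[OF l(2)] w len by simp
        then show False using no_tie[OF ne(2) w(2,3) len(1,2)] 1 by blast
      next
        \<comment> \<open>If \<open>v\<close> comes first, the same argument applies to the
          inverses: the word of \<open>z (linv l2)\<close> starts with \<open>v\<close>, and
          \<open>z (linv l1)\<close> follows it.\<close>
        case 2
        have "length u \<le> length (word_inv a)" using half[OF l(1)] w len by simp
        moreover have "rword (z (linv l2)) = v @ word_inv u" "rword (z (linv l1)) = u @ word_inv a"
          using w by (simp_all add: zinv rword_uminus)
        moreover have "length u = canc (z (linv l2)) (z (linv l1))"
          using len by (simp add: zinv canc_uminus)
        ultimately show False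
          using no_tie[of "linv l2" "linv l1" v u "word_inv a"] ne len 2 by simp
      qed
    qed
    \<comment> \<open>Substituting the images into the word of the preimage of x_i returns x_i, of
      length one; a reduced family does not shorten words.\<close>
    have "\<exists>l. ract (inverse s) (fgen i) = fletter l" for i
    proof -
      define w where "w = rword (ract (inverse s) (fgen i))"
      have prod: "sum_list (map z u) = ract s (abs_free_group u)" for u
      proof (induction u)
        case (Cons l u)
        then show ?case
          using abs_free_group_append[of "[l]" u] by (simp add: z_def)
      qed (simp add: abs_free_group_Nil)
      have "length w \<le> flen (sum_list (map z w))"
        using core strict by (intro nielsen_reduced_length) (auto simp: w_def)
      also have "\<dots> = 1"
        using rword_fletter[of "(i, True)"] by (simp add: prod w_def fletter_simps)
      finally have "length w \<le> 1" .
      moreover have "w \<noteq> []" by (simp add: w_def)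
      ultimately obtain l where "w = [l]" by (cases w) auto
      then show ?thesis by (metis w_def abs_rword)
    qed
    then have "inverse s \<in> nielsen p q" by (rule signed_perm_in_nielsen)
    then show ?thesis by (metis nielsen.inverse inverse_inverse_aut)
  qed
qed

section \<open>The action in coordinates\<close>

lemma matrix_eq_axisI:
  fixes M N :: "'r::comm_ring_1 ^ 'n::finite ^ 'm"
  assumes "\<And>j. M *v axis j 1 = N *v axis j 1"
  shows "M = N"
proof -
  have "(M *v axis j 1) $ i = M $ i $ j" for M :: "'r ^ 'n ^ 'm" and i j
    by (simp add: matrix_vector_mult_def axis_def if_distrib cong: if_cong)
  then show ?thesis using assms by (metis vec_eq_iff)
qed

lemma H_mat_axis: "H_mat s *v axis a 1 = fab (lact s (fgen a))"
  by (metis H_mat_fab fab_gen)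

lemma H_mat_times: "H_mat (s * t) = H_mat s ** H_mat t"
  by (rule matrix_eq_axisI) (simp add: H_mat_axis lact_mult H_mat_fab flip: matrix_vector_mul_assoc)

lemma H_mat_one [simp]: "H_mat 1 = mat 1"
  by (rule matrix_eq_axisI) (simp add: H_mat_axis lact_one)

lemma H_mat_inverse:
  "H_mat s ** H_mat (inverse s) = mat 1" "H_mat (inverse s) ** H_mat s = mat 1"
  by (simp_all add: aut_inverse flip: H_mat_times)

lemma H_mat_nth: "H_mat s $ i $ j = fab (ract (inverse s) (fgen j)) $ i"
  by (simp add: H_mat_def lact_def)

lemma H_mat_inverse_nth: "H_mat (inverse s) $ i $ j = fab (ract s (fgen j)) $ i"
  by (simp add: H_mat_nth)

lemma axis_nth_if: "axis a x $ i = (if i = a then x else 0)"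
  by (simp add: axis_def)

lemma H_mat_perm: "bij \<pi> \<Longrightarrow> H_mat (perm_aut \<pi>) $ i $ j = (if j = \<pi> i then 1 else 0)"
  by (auto simp: H_mat_nth perm_aut_inverse bij_imp_bij_inv axis_nth_if bij_inv_eq_iff)

lemma H_mat_inverse_perm:
  "bij \<pi> \<Longrightarrow> H_mat (inverse (perm_aut \<pi>)) $ i $ j = (if i = \<pi> j then 1 else 0)"
  by (simp add: H_mat_inverse_nth axis_nth_if)

lemma H_mat_sign:
  "H_mat (sign_aut S) $ i $ j = (if i = j then if i \<in> S then - 1 else 1 else 0)"
  by (auto simp: H_mat_nth axis_nth_if)

lemma H_mat_transvection: "p \<noteq> q \<Longrightarrow>
  H_mat (transvection p q) $ i $ j =
    (if i = j then 1 else 0) - (if i = q then if j = p then 1 else 0 else 0)"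
  unfolding H_mat_nth
  by (simp add: diff_conv_add_uminus axis_nth_if del: add_uminus_conv_diff)

lemma H_mat_inverse_transvection: "p \<noteq> q \<Longrightarrow>
  H_mat (inverse (transvection p q)) $ i $ j =
    (if i = j then 1 else 0) + (if i = q then if j = p then 1 else 0 else 0)"
  by (simp add: H_mat_inverse_nth axis_nth_if)

definition co :: "('n::finite, 'r::comm_ring_1) VL \<Rightarrow> 'n \<Rightarrow> 'n \<Rightarrow> 'n \<Rightarrow> 'r" where
  "co v k i j = ext2_coeff (v $ k) $ i $ j"

lemma VL_eqI: "(\<And>k i j. co v k i j = co w k i j) \<Longrightarrow> v = w"
  by (simp add: co_def vec_eq_iff flip: ext2_coeff_inject)

lemma ext2_coeff_sum: "ext2_coeff (sum f S) = (\<Sum>x\<in>S. ext2_coeff (f x))"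
  by (induction S rule: infinite_finite_induct) (simp_all add: zero_ext2.rep_eq plus_ext2.rep_eq)

lemma co_simps [simp]:
  "co 0 k i j = 0"
  "co (v + w) k i j = co v k i j + co w k i j"
  "co (v - w) k i j = co v k i j - co w k i j"
  "co (- v) k i j = - co v k i j"
  "co (VL_scale r v) k i j = r * co v k i j"
  by (simp_all add: co_def VL_scale_def zero_ext2.rep_eq plus_ext2.rep_eq minus_ext2.rep_eq
      uminus_ext2.rep_eq ext2_scale.rep_eq)

lemma co_VL_of_int [simp]: "co (VL_of_int v) k i j = of_int (co v k i j)"
  by (simp add: co_def VL_of_int_def ext2_of_int.rep_eq)

lemma co_alternating: "co v k i i = 0" "co v k i j + co v k j i = 0"
  using ext2_coeff[of "v $ k"] by (auto simp: co_def alternating_def)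

lemma co_swap: "co v k j i = - co v k i j"
  using co_alternating(2)[of v k i j] by (simp add: eq_neg_iff_add_eq_0 add.commute)

lemma wedge_coeff: "ext2_coeff (wedge a b) $ i $ j = a $ i * b $ j - a $ j * b $ i"
  by (simp add: wedge.rep_eq)

lemma co_act: "co (VL_act s v) k i j =
  (\<Sum>a\<in>UNIV. \<Sum>b\<in>UNIV. of_int (H_mat s $ i $ a) *
    (\<Sum>l\<in>UNIV. of_int (H_mat (inverse s) $ l $ k) * co v l a b) * of_int (H_mat s $ j $ b))"
  by (simp add: co_def VL_act_def ext2_map.rep_eq tensor2_map_nth ext2_coeff_sum ext2_scale.rep_eq)

lemma if_mult_zero:
  "(if b then x else 0) * y = (if b then x * y else 0)"
  "y * (if b then x else 0) = (if b then y * x else (0 :: 'r::comm_ring_1))"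
  "of_int (if b then m else 0) = (if b then of_int m else (0 :: 'r))"
  by simp_all

lemma co_perm [simp]:
  "bij \<pi> \<Longrightarrow> co (VL_act (perm_aut \<pi>) v) k i j = co v (\<pi> k) (\<pi> i) (\<pi> j)"
  by (simp add: co_act H_mat_perm H_mat_inverse_perm if_mult_zero)

lemma co_sign [simp]:
  "co (VL_act (sign_aut S) v) k i j =
    (if k \<in> S then - 1 else 1) * (if i \<in> S then - 1 else 1) * (if j \<in> S then - 1 else 1) * co v k i j"
  by (simp add: co_act H_mat_sign if_mult_zero)

text \<open>On H the left action is e_p -> e_p - e_q, on H^* it is e_q^* -> e_q^* + e_p^*.
  \<open>w\<close> is the result on the H^* factor alone; the two corrections from Lambda^2 H meet
  only in the diagonal term \<open>w k p p\<close>, which is zero.\<close>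

lemma co_transvection:
  fixes v :: "('n::finite, 'r::comm_ring_1) VL"
  assumes "p \<noteq> q"
  defines "w \<equiv> \<lambda>k i j. co v k i j + (if k = p then co v q i j else 0)"
  shows "co (VL_act (transvection p q) v) k i j =
    w k i j - (if i = q then w k p j else 0) - (if j = q then w k i p else 0)"
proof -
  have 1: "(\<Sum>l\<in>UNIV. of_int (H_mat (inverse (transvection p q)) $ l $ k) * co v l a b) = w k a b"
    for a b
    using assms(1)
    by (simp add: H_mat_inverse_transvection distrib_right sum.distrib if_mult_zero w_def)
  have 2: "(\<Sum>b\<in>UNIV. f b * of_int (H_mat (transvection p q) $ j $ b)) =
      f j - (if j = q then f p else 0)" for f :: "'n \<Rightarrow> 'r" and j
    using assms(1)
    by (simp add: H_mat_transvection right_diff_distrib sum_subtractf if_mult_zero)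
  have 3: "(\<Sum>a\<in>UNIV. of_int (H_mat (transvection p q) $ i $ a) * f a) =
      f i - (if i = q then f p else 0)" for f :: "'n \<Rightarrow> 'r"
    using 2[of f i] by (simp add: mult.commute)
  have "w k p p = 0" by (simp add: w_def co_alternating)
  then show ?thesis
    unfolding co_act 1 mult.assoc sum_distrib_left[symmetric] 2 3 by (auto simp: algebra_simps)
qed

lemma VL_of_int_simps:
  "VL_of_int 0 = 0" "VL_of_int (v + w) = VL_of_int v + VL_of_int w"
  "VL_of_int (v - w) = VL_of_int v - VL_of_int w"
  by (rule VL_eqI; simp)+

lemma VL_act_of_int: "VL_act s (VL_of_int v) = VL_of_int (VL_act s v)"
  by (rule VL_eqI) (simp add: co_act)

abbreviation of_int_mat :: "int ^ 'n ^ 'm \<Rightarrow> 'r::comm_ring_1 ^ 'n ^ 'm" where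
  "of_int_mat M \<equiv> (\<chi> i j. of_int (M $ i $ j))"

lemma of_int_mat_times: "of_int_mat (M ** N) = of_int_mat M ** of_int_mat N"
  by (simp add: vec_eq_iff matrix_matrix_mult_def)

lemma tensor2_map_times: "tensor2_map (M ** N) T = tensor2_map M (tensor2_map N T)"
  by (simp add: tensor2_map_def matrix_transpose_mul matrix_mul_assoc)

lemma ext2_map_times: "ext2_map (M ** N) a = ext2_map M (ext2_map N a)"
  by transfer (rule tensor2_map_times)

lemma ext2_map_one [simp]: "ext2_map (mat 1) a = a"
  by transfer (simp add: tensor2_map_def transpose_mat)

lemma ext2_map_sum: "ext2_map M (sum f S) = (\<Sum>x\<in>S. ext2_map M (f x))"
proof (induction S rule: infinite_finite_induct)
  case empty
  show ?case using ext2_map_add[of M 0 0] by simp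
next
  case (infinite A)
  then show ?case using ext2_map_add[of M 0 0] by simp
qed (simp_all add: ext2_map_add)

lemma ext2_scale_sum_left: "ext2_scale (sum f S) a = (\<Sum>x\<in>S. ext2_scale (f x) a)"
proof (induction S rule: infinite_finite_induct)
  case empty
  show ?case using ext2_scale_simps(2)[of 0 0 a] by simp
next
  case (infinite A)
  then show ?case using ext2_scale_simps(2)[of 0 0 a] by simp
qed (simp_all add: ext2_scale_simps)

lemma VL_act_times: "VL_act (s * t) v = VL_act s (VL_act t (v :: ('n::finite, 'r::comm_ring_1) VL))"
proof -
  have "(\<Sum>l\<in>UNIV. ext2_scale (of_int (H_mat (inverse (s * t)) $ l $ k)) (v $ l)) =
      (\<Sum>l\<in>UNIV. ext2_scale (of_int (H_mat (inverse s) $ l $ k))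
        (\<Sum>m\<in>UNIV. ext2_scale (of_int (H_mat (inverse t) $ m $ l)) (v $ m)))" for k
  proof -
    have "(\<Sum>l\<in>UNIV. ext2_scale (of_int (H_mat (inverse (s * t)) $ l $ k)) (v $ l)) =
        (\<Sum>l\<in>UNIV. \<Sum>m\<in>UNIV. ext2_scale (of_int (H_mat (inverse t) $ l $ m) *
          of_int (H_mat (inverse s) $ m $ k)) (v $ l))"
      by (simp add: inverse_times_aut H_mat_times matrix_matrix_mult_def ext2_scale_sum_left)
    also have "\<dots> = (\<Sum>m\<in>UNIV. \<Sum>l\<in>UNIV. ext2_scale (of_int (H_mat (inverse t) $ l $ m) *
          of_int (H_mat (inverse s) $ m $ k)) (v $ l))"
      by (rule sum.swap)
    finally show ?thesis
      by (simp add: ext2_scale_sum ext2_scale_simps mult.commute)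
  qed
  then show ?thesis
    by (simp add: VL_act_def vec_eq_iff H_mat_times of_int_mat_times ext2_map_times
        flip: ext2_map_scale ext2_map_sum)
qed

lemma VL_act_one [simp]: "VL_act 1 v = v"
proof -
  have "inverse 1 = (1 :: 'a aut)" using aut_inverse(1)[of "1 :: 'a aut"] by simp
  then show ?thesis
    by (intro VL_eqI) (simp add: co_act mat_def if_mult_zero)
qed

lemma VL_act_uminus: "VL_act s (- v) = - VL_act s v"
  using VL_act_diff[of s 0 v] by (simp add: VL_act_zero)

lemmas VL_act_simps = VL_act_add VL_act_diff VL_act_uminus VL_act_zero VL_act_scale


section \<open>Crossed homomorphisms\<close>

lemma crossed_hom_times: "crossed_hom f \<Longrightarrow> f (s * t) = f s + VL_act s (f t)"
  by (simp add: crossed_hom_def)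

lemma crossed_hom_add:
  "crossed_hom f \<Longrightarrow> crossed_hom g \<Longrightarrow> crossed_hom (\<lambda>s. f s + g s)"
  by (simp add: crossed_hom_def VL_act_simps)

lemma crossed_hom_diff:
  "crossed_hom f \<Longrightarrow> crossed_hom g \<Longrightarrow> crossed_hom (\<lambda>s. f s - g s)"
  by (simp add: crossed_hom_def VL_act_simps)

lemma crossed_hom_scale: "crossed_hom f \<Longrightarrow> crossed_hom (\<lambda>s. VL_scale r (f s))"
  by (simp add: crossed_hom_def VL_act_simps VL_scale_simps)

lemma crossed_hom_principal: "crossed_hom (\<lambda>s. VL_act s m - m)"
  by (simp add: crossed_hom_def VL_act_times VL_act_simps)

lemma crossed_hom_of_int: "crossed_hom F \<Longrightarrow> crossed_hom (\<lambda>s. VL_of_int (F s))"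
  by (simp add: crossed_hom_def VL_of_int_simps VL_act_of_int)

lemma crossed_hom_eq_zero:
  assumes "crossed_hom f" "p \<noteq> q"
    "\<And>\<pi>. bij \<pi> \<Longrightarrow> f (perm_aut \<pi>) = 0" "\<And>S. f (sign_aut S) = 0" "f (transvection p q) = 0"
  shows "f s = 0"
  using nielsen_generates[OF assms(2), of s]
proof induction
  case (inverse s)
  have "f 1 = 0" using crossed_hom_times[OF assms(1), of 1 1] by simp
  then show ?case
    using crossed_hom_times[OF assms(1), of "inverse s" s] inverse.IH
    by (simp add: aut_inverse VL_act_zero)
qed (simp_all add: assms crossed_hom_times[OF assms(1)] VL_act_zero)

section \<open>Kawazumi's crossed homomorphism\<close>

lemma hom_fab_int:
  fixes h :: "'n::finite free_group \<Rightarrow> int"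
  assumes "\<And>x y. h (x + y) = h x + h y"
  shows "h x = (\<Sum>l\<in>UNIV. fab x $ l * h (fgen l))"
  by (rule free_group_hom_eqI)
    (simp_all add: assms distrib_right sum.distrib axis_nth_if if_mult_zero cong: if_cong)

lemma hom_fab_ext2:
  fixes h :: "'n::finite free_group \<Rightarrow> ('m::finite, int) ext2"
  assumes "\<And>x y. h (x + y) = h x + h y"
  shows "h x = (\<Sum>l\<in>UNIV. ext2_scale (fab x $ l) (h (fgen l)))"
proof -
  have "ext2_coeff (h x) $ i $ j = (\<Sum>l\<in>UNIV. fab x $ l * ext2_coeff (h (fgen l)) $ i $ j)" for i j
    by (rule hom_fab_int) (simp add: assms plus_ext2.rep_eq)
  then show ?thesis
    by (simp add: vec_eq_iff ext2_coeff_sum ext2_scale.rep_eq flip: ext2_coeff_inject)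
qed

lemma surj_fab: "\<exists>x. fab x = h"
proof -
  have axis: "\<exists>x. fab x = axis i c" for i and c :: int
  proof (induction c rule: int_induct[of _ 0])
    case base
    show ?case by (rule exI[of _ 0]) (simp add: vec_eq_iff axis_nth_if)
  next
    case (step1 c)
    then obtain x where "fab x = axis i c" by blast
    then show ?case
      by (intro exI[of _ "x + fgen i"]) (simp add: vec_eq_iff axis_nth_if)
  next
    case (step2 c)
    then obtain x where "fab x = axis i c" by blast
    then show ?case
      by (intro exI[of _ "x + - fgen i"])
        (simp add: vec_eq_iff axis_nth_if del: add_uminus_conv_diff)
  qed
  have "\<exists>x. fab x = (\<chi> i. if i \<in> S then h $ i else 0)" for S
    using finite[of S]
  proof (induction S rule: finite_induct)
    case empty
    show ?case by (rule exI[of _ 0]) (simp add: vec_eq_iff)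
  next
    case (insert a S)
    then obtain x y where "fab x = (\<chi> i. if i \<in> S then h $ i else 0)" "fab y = axis a (h $ a)"
      using axis by blast
    then show ?case
      using insert.hyps by (intro exI[of _ "x + y"]) (auto simp: vec_eq_iff axis_nth_if)
  qed
  from this[of UNIV] show ?thesis by simp
qed

text \<open>Such an \<open>h\<close> factors through H, where the inverse of |s| takes [x_k] to the
  class of x_k^s. So the action on H^* becomes the right action on F_n.\<close>

lemma VL_act_hom:
  fixes h :: "'n::finite free_group \<Rightarrow> ('n, int) ext2"
  assumes "\<And>x y. h (x + y) = h x + h y"
  shows "VL_act s (\<chi> k. h (fgen k)) $ k = ext2_map (H_mat s) (h (ract s (fgen k)))"
  by (subst (2) hom_fab_ext2[OF assms]) (simp add: VL_act_def H_mat_inverse_nth)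

lemma tensor2_map_add: "tensor2_map M (S + T) = tensor2_map M S + tensor2_map M T"
  by (simp add: vec_eq_iff tensor2_map_nth algebra_simps sum.distrib)

lemma tensor2_map_diff: "tensor2_map M (S - T) = tensor2_map M S - tensor2_map M T"
  by (simp add: vec_eq_iff tensor2_map_nth algebra_simps sum_subtractf)

lemma H_mat_fab_ract: "H_mat s *v fab (ract s x) = fab x"
  by (metis H_mat_fab lact_inverse lact_mult lact_one aut_inverse(2))

lemma ext2_proj_add: "ext2_proj (S + T) = ext2_proj S + ext2_proj T"
  by transfer (simp add: vec_eq_iff transpose_def)

lemma ext2_proj_diff: "ext2_proj (S - T) = ext2_proj S - ext2_proj T"
  by transfer (simp add: vec_eq_iff transpose_def)

lemma ext2_proj_tensor2_map: "ext2_proj (tensor2_map M T) = ext2_map M (ext2_proj T)"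
proof transfer
  fix M T :: "'r::comm_ring_1 ^ 'm::finite ^ 'm"
  have "transpose (tensor2_map M T) = tensor2_map M (transpose T)"
    by (simp add: tensor2_map_def matrix_transpose_mul matrix_mul_assoc)
  then show "tensor2_map M T - transpose (tensor2_map M T) = tensor2_map M (T - transpose T)"
    by (simp add: vec_eq_iff tensor2_map_nth algebra_simps sum_subtractf)
qed

lemma ext2_scale_zero_left [simp]: "ext2_scale 0 a = 0"
  using ext2_scale_simps(2)[of 0 0 a] by simp

lemma ext2_eqI: "(\<And>i j. ext2_coeff v $ i $ j = ext2_coeff w $ i $ j) \<Longrightarrow> v = w"
  by (simp add: vec_eq_iff flip: ext2_coeff_inject)

lemma ext2_map_zero: "ext2_map M 0 = 0"
  using ext2_map_add[of M 0 0] by simp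

context
  fixes \<theta> :: "'n::finite free_group \<Rightarrow> 'n ctensor"
  assumes magnus: "magnus_expansion \<theta>"
begin

lemma degree2_add:
  "degree2 (\<theta> (x + y)) = degree2 (\<theta> x) + degree2 (\<theta> y) + tensor2 (fab x) (fab y)"
proof -
  have "{..Suc (Suc 0)} = {0, 1, 2}" by auto
  then show ?thesis
    using magnus
    by (simp add: magnus_expansion_def degree2_def tensor2_def vec_eq_iff ctensor_mult_def)
qed

text \<open>The Johnson map before it descends to H. Computing on F_n confines the definite
  description in \<open>johnson_map\<close> to \<open>johnson_map_fab\<close>.\<close>

definition johnson :: "'n aut \<Rightarrow> 'n free_group \<Rightarrow> int ^ 'n ^ 'n" where
  "johnson s x = degree2 (\<theta> x) - tensor2_map (H_mat s) (degree2 (\<theta> (ract s x)))"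

text \<open>The defect of additivity of theta_2 is [x] (x) [y]. Both terms of \<open>johnson\<close>
  contribute the same defect, because |s| takes [x^s] to [x].\<close>

lemma johnson_add: "johnson s (x + y) = johnson s x + johnson s y"
  by (simp add: johnson_def degree2_add tensor2_map_add tensor2_map_tensor2 H_mat_fab_ract)

lemma johnson_times: "johnson (s * t) x = johnson s x + tensor2_map (H_mat s) (johnson t (ract s x))"
  by (simp add: johnson_def tensor2_map_diff H_mat_times tensor2_map_times)

lemma johnson_map_fab: "johnson_map \<theta> s (fab x) = johnson s x"
proof -
  define \<phi> where "\<phi> h = (\<chi> i j. \<Sum>l\<in>UNIV. h $ l * johnson s (fgen l) $ i $ j)" for h :: "int ^ 'n"
  have \<phi>: "\<phi> (fab x) = johnson s x" for x
  proof -
    have "johnson s x $ i $ j = (\<Sum>l\<in>UNIV. fab x $ l * johnson s (fgen l) $ i $ j)" for i j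
      by (rule hom_fab_int) (simp add: johnson_add)
    then show ?thesis by (simp add: \<phi>_def vec_eq_iff)
  qed
  have "johnson_map \<theta> s = (THE \<psi>. \<forall>x. \<psi> (fab x) = johnson s x)"
    by (simp add: johnson_map_def johnson_def lact_inverse)
  also have "\<dots> = \<phi>"
    using \<phi> by (intro the_equality) (auto simp: fun_eq_iff, metis surj_fab)
  finally show ?thesis by (simp add: \<phi>)
qed

definition kawazumi :: "'n aut \<Rightarrow> ('n, int) VL" where
  "kawazumi s = (\<chi> k. ext2_proj (johnson s (fgen k)))"

lemma f_K_kawazumi: "f_K \<theta> s = VL_of_int (kawazumi s)"
  using johnson_map_fab[of s "fgen _"] by (simp add: f_K_def kawazumi_def)

lemma crossed_hom_kawazumi: "crossed_hom kawazumi"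
  unfolding crossed_hom_def
proof (intro allI)
  fix s t
  have "VL_act s (kawazumi t) $ k = ext2_map (H_mat s) (ext2_proj (johnson t (ract s (fgen k))))" for k
    unfolding kawazumi_def by (rule VL_act_hom) (simp add: johnson_add ext2_proj_add)
  then show "kawazumi (s * t) = kawazumi s + VL_act s (kawazumi t)"
    by (simp add: vec_eq_iff kawazumi_def johnson_times ext2_proj_add ext2_proj_tensor2_map)
qed

text \<open>Its coboundary changes the projection of theta_2 by a homomorphism, chosen to make it
  vanish on the basis as for the expansion x_i -> 1 + e_i; the result is
  \<open>normalized2\<close>.\<close>

definition expansion_shift :: "('n, int) VL" where
  "expansion_shift = (\<chi> k. ext2_proj (degree2 (\<theta> (fgen k))))"

definition normalized2 :: "'n free_group \<Rightarrow> ('n, int) ext2" where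
  "normalized2 x = ext2_proj (degree2 (\<theta> x)) - (\<Sum>l\<in>UNIV. ext2_scale (fab x $ l) (expansion_shift $ l))"

lemma normalized2_add: "normalized2 (x + y) = normalized2 x + normalized2 y + wedge (fab x) (fab y)"
  by (simp add: normalized2_def degree2_add ext2_proj_add ext2_proj_tensor2 ext2_scale_simps
      sum.distrib)

lemma normalized2_gen: "normalized2 (fgen a) = 0"
  by (simp add: normalized2_def expansion_shift_def axis_nth_if if_distrib[of "\<lambda>r. ext2_scale r _"]
      ext2_scale_simps cong: if_cong)

text \<open>Inverse letters are covered because [x] ^ [x] = 0; before the projection a term [x] (x)
  [x] would remain. This is what normalizes sign changes along with permutations.\<close>

lemma normalized2_fletter: "normalized2 (fletter l) = 0"
proof -
  have w: "wedge v (- v) = 0" "wedge (0 :: int ^ 'n) v = 0" for v :: "int ^ 'n"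
    by (rule ext2_eqI; simp add: wedge_coeff zero_ext2.rep_eq)+
  have "normalized2 0 = 0" using normalized2_add[of 0 0] w by simp
  moreover have "normalized2 0 = normalized2 (- fgen a)" for a
    using normalized2_add[of "fgen a" "- fgen a"] w by (simp add: normalized2_gen)
  ultimately show ?thesis using normalized2_gen by (simp add: fletter_if)
qed

lemma kawazumi_normalized_nth:
  "(kawazumi s + (VL_act s expansion_shift - expansion_shift)) $ k =
    - ext2_map (H_mat s) (normalized2 (ract s (fgen k)))"
proof -
  have map_diff: "ext2_map (H_mat s) (a - b) = ext2_map (H_mat s) a - ext2_map (H_mat s) b" for a b
    using ext2_map_add[of "H_mat s" "a - b" b] by (simp add: algebra_simps)
  show ?thesis
    by (simp add: kawazumi_def johnson_def normalized2_def map_diff ext2_proj_diff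
        ext2_proj_tensor2_map VL_act_def H_mat_inverse_nth expansion_shift_def)
qed

lemma kawazumi_normalized_signed_perm:
  assumes "\<And>k. \<exists>l. ract s (fgen k) = fletter l"
  shows "kawazumi s + (VL_act s expansion_shift - expansion_shift) = 0"
proof -
  have "(kawazumi s + (VL_act s expansion_shift - expansion_shift)) $ k = 0" for k
    unfolding kawazumi_normalized_nth
    using assms[of k] by (auto simp: normalized2_fletter ext2_map_zero)
  then show ?thesis by (simp only: vec_eq_iff zero_index simp_thms)
qed

text \<open>On x_p x_q the map \<open>normalized2\<close> is e_p ^ e_q, and the action e_p -> e_p -
  e_q fixes this wedge. So the value on E is - e_p^* (x) e_p ^ e_q.\<close>

lemma kawazumi_normalized_transvection:
  assumes "p \<noteq> q"
  shows "co (kawazumi (transvection p q) +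
      (VL_act (transvection p q) expansion_shift - expansion_shift)) k i j =
    (if k = p then (if i = q \<and> j = p then 1 else 0) - (if i = p \<and> j = q then 1 else 0) else 0)"
proof -
  have "H_mat (transvection p q) *v axis p 1 = axis p 1 - axis q 1"
    "H_mat (transvection p q) *v axis q 1 = axis q 1"
    using assms
    by (auto simp: vec_eq_iff matrix_vector_mult_def H_mat_transvection axis_nth_if
        left_diff_distrib if_mult_zero sum_subtractf cong: if_cong)
  moreover have "normalized2 (fgen p + fgen q) = wedge (axis p 1) (axis q 1)"
    by (simp add: normalized2_add normalized2_gen)
  ultimately show ?thesis
    using assms normalized2_gen
    unfolding co_def kawazumi_normalized_nth
    by (auto simp: ext2_map_wedge ext2_map_zero wedge_coeff zero_ext2.rep_eq
        uminus_ext2.rep_eq axis_nth_if)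
qed

end

section \<open>Morita's crossed homomorphism\<close>

lemma frag_hom_eqI:
  assumes "\<And>a b :: 'a \<Rightarrow>\<^sub>0 int. h (a - b) = (h a - h b :: 'b::group_add)" "\<And>a b. k (a - b) = k a - k b"
    "\<And>x. h (frag_of x) = k (frag_of x)"
  shows "h c = k c"
  using subset_UNIV[of "Poly_Mapping.keys c"]
proof (induction c rule: frag_induction)
  case zero
  show ?case using assms(1,2)[of 0 0] by simp
qed (simp_all add: assms)

lemma group_ring_bar_mult:
  fixes x :: "'g::group_add"
  shows "group_ring_bar (frag_of x * c) = group_ring_bar c * frag_of (- x)"
  unfolding group_ring_bar_def
  by (rule frag_hom_eqI[of _ _ c])
    (simp_all add: frag_extend_diff right_diff_distrib left_diff_distrib frag_of_mult minus_add
      del: single_of_nat)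

lemma group_ring_ab_mult: "group_ring_ab (c * frag_of x) = group_ring_ab c * frag_of (fab x)"
  unfolding group_ring_ab_def
  by (rule frag_hom_eqI[of _ _ c])
    (simp_all add: frag_extend_diff left_diff_distrib frag_of_mult)

section \<open>Fox derivatives over Z[H] and the chain rule\<close>

definition magnus_fox :: "'n::finite \<Rightarrow> 'n free_group \<Rightarrow> (int ^ 'n) \<Rightarrow>\<^sub>0 int" where
  "magnus_fox i x = group_ring_ab (group_ring_bar (fox i x))"

lemma magnus_rep_nth: "magnus_rep s $ i $ j = magnus_fox i (lact s (fgen j))"
  by (simp add: magnus_rep_def magnus_fox_def fox_derivative_def)

text \<open>The bar reverses products: the factor x to the left of the Fox derivative of y becomes
  the group element of -[x] on its right.\<close>

lemma magnus_fox_add: "magnus_fox i (x + y) = magnus_fox i x + magnus_fox i y * frag_of (- fab x)"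
proof -
  have "group_ring_ab (group_ring_bar (frag_of x * fox i y)) = magnus_fox i y * frag_of (- fab x)"
    by (simp add: group_ring_bar_mult group_ring_ab_mult magnus_fox_def)
  moreover have "group_ring_bar (a + b) = group_ring_bar a + group_ring_bar b"
    for a b :: "'a free_group \<Rightarrow>\<^sub>0 int" by (simp add: group_ring_bar_def frag_extend_add)
  moreover have "group_ring_ab (a + b) = group_ring_ab a + group_ring_ab b"
    for a b :: "'a free_group \<Rightarrow>\<^sub>0 int" by (simp add: group_ring_ab_def frag_extend_add)
  ultimately show ?thesis by (simp add: magnus_fox_def fox_add)
qed

lemma magnus_fox_gen: "magnus_fox i (fgen j) = (if i = j then 1 else 0)"
proof -
  have "group_ring_ab (group_ring_bar (frag_of (0 :: 'a free_group))) = frag_of 0"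
    by (simp add: group_ring_bar_def group_ring_ab_def del: frag_of_zero single_one)
  then show ?thesis
    by (simp add: magnus_fox_def fox_gen) (simp add: group_ring_bar_def group_ring_ab_def)
qed

lemma magnus_fox_zero [simp]: "magnus_fox i 0 = 0"
  using magnus_fox_add[of i 0 0] by simp

lemma magnus_fox_uminus: "magnus_fox i (- x) = - magnus_fox i x * frag_of (fab x)"
  using magnus_fox_add[of i "- x" x] by (simp add: eq_neg_iff_add_eq_0)

definition H_ring_map :: "'n::finite aut \<Rightarrow> ((int ^ 'n) \<Rightarrow>\<^sub>0 int) \<Rightarrow> (int ^ 'n) \<Rightarrow>\<^sub>0 int" where
  "H_ring_map s = frag_extend (\<lambda>h. frag_of (H_mat s *v h))"

lemma H_ring_map_frag_of [simp]: "H_ring_map s (frag_of h) = frag_of (H_mat s *v h)"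
  by (simp add: H_ring_map_def)

lemma H_ring_map_add: "H_ring_map s (a + b) = H_ring_map s a + H_ring_map s b"
  by (simp add: H_ring_map_def frag_extend_add)

lemma H_ring_map_diff: "H_ring_map s (a - b) = H_ring_map s a - H_ring_map s b"
  by (simp add: H_ring_map_def frag_extend_diff)

lemma H_ring_map_uminus: "H_ring_map s (- a) = - H_ring_map s a"
  by (simp add: H_ring_map_def frag_extend_minus)

lemma H_ring_map_zero: "H_ring_map s 0 = 0"
  by (simp add: H_ring_map_def)

lemma H_ring_map_one: "H_ring_map s 1 = 1"
  using H_ring_map_frag_of[of s 0] by simp

lemma H_ring_map_mult: "H_ring_map s (a * b) = H_ring_map s a * H_ring_map s b"
proof (rule frag_hom_eqI[of _ _ a])
  fix x
  show "H_ring_map s (frag_of x * b) = H_ring_map s (frag_of x) * H_ring_map s b"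
    by (rule frag_hom_eqI[of _ _ b])
      (simp_all only: H_ring_map_diff right_diff_distrib frag_of_mult H_ring_map_frag_of
        matrix_vector_right_distrib)
qed (simp_all add: H_ring_map_diff left_diff_distrib)

lemma H_mat_uminus: "H_mat s *v (- h) = - (H_mat s *v h)"
  using matrix_vector_right_distrib[of "H_mat s" "- h" h] by (simp add: eq_neg_iff_add_eq_0)

text \<open>Both sides obey the same twisted product rule in x, so equality spreads from the basis
  to sums and inverses. Entry by entry it says that the Magnus matrices are multiplicative up to the
  action on Z[H].\<close>

lemma magnus_fox_chain_rule:
  "magnus_fox i (lact s x) = (\<Sum>k\<in>UNIV. magnus_fox i (lact s (fgen k)) * H_ring_map s (magnus_fox k x))"
proof -
  note lact_hom = hom_zero[of "lact s", OF lact_add] hom_uminus[of "lact s", OF lact_add]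
  let ?P = "\<lambda>x. magnus_fox i (lact s x) =
    (\<Sum>k\<in>UNIV. magnus_fox i (lact s (fgen k)) * H_ring_map s (magnus_fox k x))"
  have gen: "?P (fgen a)" for a
    by (simp add: magnus_fox_gen if_distrib[of "H_ring_map s"] H_ring_map_one H_ring_map_zero
        if_mult_zero cong: if_cong)
  have uminus: "?P (- x)" if "?P x" for x
    using that
    by (simp add: lact_hom magnus_fox_uminus H_ring_map_mult H_ring_map_uminus H_mat_fab
        sum_distrib_right sum_negf mult.assoc)
  have add: "?P (x + y)" if "?P x" "?P y" for x y
    using that
    by (simp add: lact_add magnus_fox_add H_ring_map_mult H_ring_map_add H_mat_uminus H_mat_fab
        distrib_left sum.distrib sum_distrib_right mult.assoc)
  show ?thesis
  proof (induction x rule: free_group_induct)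
    case zero
    show ?case by (simp add: lact_hom H_ring_map_zero)
  qed (intro add uminus gen; assumption)+
qed

lemma magnus_rep_times:
  "magnus_rep (s * t) = magnus_rep s ** (\<chi> i j. H_ring_map s (magnus_rep t $ i $ j))"
  by (simp add: vec_eq_iff matrix_matrix_mult_def magnus_rep_nth lact_mult
      magnus_fox_chain_rule[of _ _ "lact t (fgen _)"])

lemma det_ring_hom:
  fixes A :: "'a::comm_ring_1 ^ 'n::finite ^ 'n" and h :: "'a \<Rightarrow> 'b::comm_ring_1"
  assumes add: "\<And>x y. h (x + y) = h x + h y" and mult: "\<And>x y. h (x * y) = h x * h y"
    and one: "h 1 = 1"
  shows "det (\<chi> i j. h (A $ i $ j)) = h (det A)"
proof -
  have zero: "h 0 = 0" by (rule hom_zero) (rule add)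
  have uminus: "h (- x) = - h x" for x by (rule hom_uminus) (rule add)
  have sum: "h (sum f S) = (\<Sum>x\<in>S. h (f x))" for f :: "('n \<Rightarrow> 'n) \<Rightarrow> 'a" and S
    by (induction S rule: infinite_finite_induct) (simp_all add: zero add)
  have prod: "h (prod f S) = (\<Prod>x\<in>S. h (f x))" for f :: "'n \<Rightarrow> 'a" and S
    by (induction S rule: infinite_finite_induct) (simp_all add: one mult)
  have sign: "h (of_int (sign p)) = of_int (sign p)" for p :: "'n \<Rightarrow> 'n"
    by (cases p rule: sign_cases) (simp_all add: one uminus)
  show ?thesis by (simp add: det_def sum prod sign mult)
qed

section \<open>The signed determinant and its values on generators\<close>

definition magnus_det :: "'n::finite aut \<Rightarrow> (int ^ 'n) \<Rightarrow>\<^sub>0 int" where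
  "magnus_det s = of_int (det (H_mat s)) * det (magnus_rep s)"

lemma H_ring_map_of_int: "H_ring_map s (of_int m) = of_int m"
proof -
  have nat: "H_ring_map s (of_nat k) = of_nat k" for k
    by (induction k) (simp_all add: H_ring_map_zero H_ring_map_one H_ring_map_add)
  show ?thesis
    by (cases m rule: int_cases2) (simp_all add: nat H_ring_map_uminus)
qed

lemma magnus_det_times: "magnus_det (s * t) = magnus_det s * H_ring_map s (magnus_det t)"
  by (simp add: magnus_det_def H_mat_times magnus_rep_times det_mul H_ring_map_mult
      H_ring_map_of_int ac_simps
      det_ring_hom[of "H_ring_map s", OF H_ring_map_add H_ring_map_mult H_ring_map_one])

lemma det_H_mat_square: "det (H_mat s) * det (H_mat s) = 1"
proof -
  have "det (H_mat s) * det (H_mat (inverse s)) = 1"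
    by (simp add: H_mat_inverse flip: det_mul)
  then have "det (H_mat s) = 1 \<or> det (H_mat s) = - 1" by (auto simp: zmult_eq_1_iff)
  then show ?thesis by auto
qed

text \<open>No inverse letters occur, so the Magnus matrix is the permutation matrix on H, and the
  sign cancels its determinant.\<close>

lemma magnus_det_perm:
  assumes "bij \<pi>"
  shows "magnus_det (perm_aut \<pi>) = frag_of 0"
proof -
  have "magnus_rep (perm_aut \<pi>) $ i $ j = of_int (H_mat (perm_aut \<pi>) $ i $ j)" for i j
    using assms
    by (simp add: magnus_rep_nth H_mat_def lact_def perm_aut_inverse bij_imp_bij_inv magnus_fox_gen
        axis_nth_if)
  then have "magnus_rep (perm_aut \<pi>) = (\<chi> i j. of_int (H_mat (perm_aut \<pi>) $ i $ j))"
    by (simp add: vec_eq_iff)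
  then have "magnus_det (perm_aut \<pi>) = of_int (det (H_mat (perm_aut \<pi>)) * det (H_mat (perm_aut \<pi>)))"
    by (simp add: magnus_det_def det_ring_hom[of of_int])
  then show ?thesis by (simp add: det_H_mat_square)
qed

lemma prod_frag_of: "finite S \<Longrightarrow> (\<Prod>a\<in>S. frag_of (f a)) = frag_of (\<Sum>a\<in>S. f a :: 'b::comm_monoid_add)"
  by (induction S rule: finite_induct) (simp_all add: frag_of_mult)

lemma magnus_det_sign: "magnus_det (sign_aut S) = frag_of (\<Sum>a\<in>S. axis a 1)"
proof -
  have "magnus_rep (sign_aut S) $ i $ j =
      (if i = j then if i \<in> S then - frag_of (axis i 1) else 1 else 0)" for i j
    by (simp add: magnus_rep_nth lact_def magnus_fox_uminus magnus_fox_gen)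
  then have "det (magnus_rep (sign_aut S)) = (\<Prod>i\<in>UNIV. if i \<in> S then - frag_of (axis i 1) else 1)"
    by (subst det_diagonal) simp_all
  moreover have "det (H_mat (sign_aut S)) = (\<Prod>i\<in>UNIV. if i \<in> S then - 1 else 1)"
    by (subst det_diagonal) (simp_all add: H_mat_sign)
  ultimately have "magnus_det (sign_aut S) =
      (\<Prod>i\<in>UNIV. of_int (if i \<in> S then - 1 else 1) * (if i \<in> S then - frag_of (axis i 1) else 1))"
    by (simp only: magnus_det_def prod.distrib of_int_prod)
  also have "\<dots> = (\<Prod>i\<in>UNIV. if i \<in> S then frag_of (axis i 1) else 1)"
    by (intro prod.cong) auto
  also have "\<dots> = (\<Prod>i\<in>S. frag_of (axis i 1))"
    by (simp add: prod.If_cases)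
  finally show ?thesis by (simp add: prod_frag_of)
qed

lemma det_elementary:
  fixes A :: "'r::comm_ring_1 ^ 'n::finite ^ 'n"
  assumes "p \<noteq> q" "\<And>i j. A $ i $ j = (if i = j then 1 else 0) + (if i = q \<and> j = p then c else 0)"
  shows "det A = 1"
proof -
  have "A = (\<chi> k. if k = q then row q (mat 1) + c *s row p (mat 1) else row k (mat 1))"
    using assms by (auto simp: vec_eq_iff row_def mat_def)
  then show ?thesis using det_row_operation[where A = "mat 1" and c = c, OF assms(1)[symmetric]] by simp
qed

lemma magnus_det_transvection:
  assumes "p \<noteq> q"
  shows "magnus_det (transvection p q) = frag_of 0"
proof -
  have "magnus_fox i (fgen p - fgen q) =
      (if i = p then 1 else 0) + (if i = q then - frag_of (axis q 1) * frag_of (- axis p 1) else 0)" for i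
    unfolding diff_conv_add_uminus[of "fgen p"] magnus_fox_add magnus_fox_uminus magnus_fox_gen by simp
  then have "magnus_rep (transvection p q) $ i $ j = (if i = j then 1 else 0) +
      (if i = q \<and> j = p then - frag_of (axis q 1) * frag_of (- axis p 1) else 0)" for i j
    using assms by (simp add: magnus_rep_nth lact_def magnus_fox_gen)
  then have "det (magnus_rep (transvection p q)) = 1" by (rule det_elementary[OF assms])
  moreover have "det (H_mat (transvection p q)) = 1"
    by (rule det_elementary[OF assms, of _ "- 1"]) (use assms in \<open>simp add: H_mat_transvection\<close>)
  ultimately show ?thesis by (simp add: magnus_det_def)
qed

text \<open>Values in H persist under products and inverses by \<open>magnus_det_times\<close>, so
  Nielsen's generators suffice. Together with injectivity of \<open>frag_of\<close> this gives the
  \<open>THE\<close> in \<open>morita_H\<close> its meaning.\<close>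

lemma ex_magnus_det:
  assumes "p \<noteq> (q :: 'n::finite)"
  shows "\<exists>h. magnus_det (s :: 'n aut) = frag_of h"
  using nielsen_generates[OF assms, of s]
proof induction
  case (mult s t)
  then obtain h k where "magnus_det s = frag_of h" "magnus_det t = frag_of k" by blast
  then have "magnus_det (s * t) = frag_of (h + H_mat s *v k)"
    by (simp add: magnus_det_times frag_of_mult)
  then show ?case by blast
next
  case (inverse s)
  then obtain h where h: "magnus_det s = frag_of h" by blast
  let ?k = "H_mat (inverse s) *v h"
  have "perm_aut id = (1 :: 'n aut)" by (rule aut_eqI) simp
  then have "magnus_det (inverse s * s) = frag_of 0"
    by (metis aut_inverse(1) bij_id magnus_det_perm)
  then have "magnus_det (inverse s) * frag_of ?k = frag_of 0" by (simp add: magnus_det_times h)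
  then have "magnus_det (inverse s) * (frag_of ?k * frag_of (- ?k)) = frag_of 0 * frag_of (- ?k)"
    by (simp only: mult.assoc[symmetric])
  then have "magnus_det (inverse s) = frag_of (- ?k)" by (simp add: frag_of_mult)
  then show ?case by blast
qed (use assms magnus_det_perm magnus_det_sign magnus_det_transvection in blast)+

lemma morita_H_eqI: "magnus_det s = frag_of h \<Longrightarrow> morita_H s = h"
  unfolding morita_H_def magnus_det_def[symmetric] by (rule the_equality) (simp_all add: frag_of_eq)

lemma morita_H_times:
  assumes "p \<noteq> (q :: 'n::finite)"
  shows "morita_H (s * t :: 'n aut) = morita_H s + H_mat s *v morita_H t"
proof -
  obtain h k where "magnus_det s = frag_of h" "magnus_det t = frag_of k"
    using ex_magnus_det[OF assms] by metis
  moreover from this have "magnus_det (s * t) = frag_of (h + H_mat s *v k)"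
    by (simp add: magnus_det_times frag_of_mult)
  ultimately show ?thesis by (simp add: morita_H_eqI)
qed

section \<open>The map from H to V and the normalized Morita class\<close>

lemma co_sum: "co (sum f S) k i j = (\<Sum>x\<in>S. co (f x) k i j)"
  by (induction S rule: infinite_finite_induct) simp_all

lemma co_H_to_V: "co (H_to_V h) k i j = (if i = k then h $ j else 0) - (if j = k then h $ i else 0)"
proof -
  have "co (\<Sum>k\<in>UNIV - {a}. axis k (wedge (axis k 1) (axis a 1))) k i j =
      (if i = k then if a = j then 1 else 0 else 0) - (if j = k then if a = i then 1 else 0 else (0::int))" for a
  proof -
    have "co (\<Sum>k\<in>UNIV - {a}. axis k (wedge (axis k 1) (axis a 1))) k i j =
        (\<Sum>m\<in>UNIV - {a}. if k = m then ext2_coeff (wedge (axis k 1) (axis a 1)) $ i $ j else (0::int))"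
      unfolding co_sum by (rule sum.cong) (auto simp: co_def axis_nth_if zero_ext2.rep_eq)
    also have "\<dots> = (if k = a then 0 else ext2_coeff (wedge (axis k 1) (axis a 1)) $ i $ j)"
      by simp
    also have "\<dots> = ext2_coeff (wedge (axis k 1) (axis a 1)) $ i $ j"
      by (simp add: wedge_coeff)
    finally show ?thesis by (auto simp: wedge_coeff axis_nth_if)
  qed
  then show ?thesis
    by (simp add: H_to_V_def co_sum right_diff_distrib sum_subtractf if_mult_zero)
qed

lemma H_to_V_add: "H_to_V (h + k) = H_to_V h + H_to_V k"
  by (rule VL_eqI) (simp add: co_H_to_V)

lemma H_to_V_diff: "H_to_V (h - k) = H_to_V h - H_to_V k"
  by (rule VL_eqI) (simp add: co_H_to_V)

text \<open>The omitted summand is e_i ^ e_i = 0, so h goes to the homomorphism [x] -> [x] ^ h;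
  equivariance is read off from this form.\<close>

lemma H_to_V_nth: "H_to_V h $ k = wedge (axis k 1) h"
proof -
  have "ext2_coeff (H_to_V h $ k) $ i $ j = ext2_coeff (wedge (axis k 1) h) $ i $ j" for i j
    using co_H_to_V[of h k i j] by (auto simp: co_def wedge_coeff axis_nth_if)
  then show ?thesis by (simp add: vec_eq_iff flip: ext2_coeff_inject)
qed

lemma wedge_add_left: "wedge (a + b) v = wedge a v + wedge b v"
  by transfer (simp add: vec_eq_iff algebra_simps)

lemma VL_act_H_to_V: "VL_act s (H_to_V h) = H_to_V (H_mat s *v h)"
proof -
  have "VL_act s (H_to_V h) $ k = H_to_V (H_mat s *v h) $ k" for k
  proof -
    have "H_to_V h = (\<chi> k. wedge (fab (fgen k)) h)" by (simp add: vec_eq_iff H_to_V_nth)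
    then show ?thesis
      using VL_act_hom[of "\<lambda>x. wedge (fab x) h" s k]
      by (simp add: wedge_add_left ext2_map_wedge H_mat_fab_ract H_to_V_nth)
  qed
  then show ?thesis by (simp add: vec_eq_iff)
qed

definition morita :: "'n::finite aut \<Rightarrow> ('n, int) VL" where
  "morita s = H_to_V (morita_H s)"

lemma crossed_hom_morita:
  assumes "p \<noteq> (q :: 'n::finite)"
  shows "crossed_hom (morita :: 'n aut \<Rightarrow> _)"
  using morita_H_times[OF assms] by (simp add: crossed_hom_def morita_def H_to_V_add VL_act_H_to_V)

text \<open>Permutations fix (1,...,1), and the sign change at S alters it by -2 times the sum of
  the e_a over S, which cancels twice the value in \<open>magnus_det_sign\<close>. Without doubling,
  half of this vector would be required.\<close>

definition morita_shift :: "('n::finite, int) VL" where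
  "morita_shift = H_to_V (\<chi> a. 1)"

lemma morita_normalized:
  "morita s + morita s + (VL_act s morita_shift - morita_shift) =
    H_to_V (morita_H s + morita_H s + (H_mat s *v (\<chi> a. 1) - (\<chi> a. 1)))"
  by (simp only: morita_def morita_shift_def VL_act_H_to_V H_to_V_add H_to_V_diff)

lemma H_to_V_zero: "H_to_V 0 = 0"
  by (rule VL_eqI) (simp add: co_H_to_V)

lemma morita_normalized_perm:
  assumes "bij \<pi>"
  shows "morita (perm_aut \<pi>) + morita (perm_aut \<pi>) +
    (VL_act (perm_aut \<pi>) morita_shift - morita_shift) = 0"
proof -
  have "H_mat (perm_aut \<pi>) *v (\<chi> a. 1) = (\<chi> a. 1)"
    using assms by (simp add: vec_eq_iff matrix_vector_mult_def H_mat_perm)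
  then show ?thesis
    using morita_H_eqI[OF magnus_det_perm[OF assms]] by (simp add: morita_normalized H_to_V_zero)
qed

lemma morita_normalized_sign:
  "morita (sign_aut S) + morita (sign_aut S) +
    (VL_act (sign_aut S) morita_shift - morita_shift) = 0"
proof -
  have "morita_H (sign_aut S) + morita_H (sign_aut S) +
      (H_mat (sign_aut S) *v (\<chi> a. 1) - (\<chi> a. 1)) = 0"
    using morita_H_eqI[OF magnus_det_sign, of S]
    by (simp add: vec_eq_iff matrix_vector_mult_def H_mat_sign axis_nth_if)
  then show ?thesis by (simp add: morita_normalized H_to_V_zero)
qed

text \<open>\<open>morita\<close> itself vanishes on E; the value comes from the shift alone, since
  E takes (1,...,1) to (1,...,1) - e_q.\<close>

lemma morita_normalized_transvection:
  assumes "p \<noteq> q"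
  shows "co (morita (transvection p q) + morita (transvection p q) +
    (VL_act (transvection p q) morita_shift - morita_shift)) k i j =
    (if j = k \<and> i = q then 1 else 0) - (if i = k \<and> j = q then 1 else 0)"
proof -
  have *: "H_mat (transvection p q) *v (\<chi> a. 1) - (\<chi> a. 1) = - axis q 1"
    using assms
    by (simp add: vec_eq_iff matrix_vector_mult_def H_mat_transvection sum_subtractf axis_nth_if)
  have "morita (transvection p q) + morita (transvection p q) +
    (VL_act (transvection p q) morita_shift - morita_shift) = H_to_V (- axis q 1)"
    by (simp only: morita_normalized morita_H_eqI[OF magnus_det_transvection[OF assms]] add_0_left *)
  moreover have "co (H_to_V (- axis q 1)) k i j = 
    (if j = k \<and> i = q then 1 else 0) - (if i = k \<and> j = q then 1 else 0)"
    unfolding co_H_to_V vector_uminus_component axis_nth_if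
    by (cases "i = k"; cases "j = k"; cases "i = q"; cases "j = q";
        simp only: if_True if_False simp_thms; simp)
  ultimately show ?thesis by (simp only:)
qed


section \<open>The first cohomology\<close>

lemma ex_bij_triple:
  assumes "p \<noteq> q" "a \<noteq> b" "r \<noteq> p" "r \<noteq> q" "c \<noteq> a" "c \<noteq> b"
  obtains \<pi> :: "'n \<Rightarrow> 'n" where "bij \<pi>" "\<pi> a = p" "\<pi> b = q" "\<pi> c = r"
proof -
  obtain \<pi> where \<pi>: "bij \<pi>" "\<pi> a = p" "\<pi> b = q" using ex_bij_pair[OF assms(1,2)] .
  then have "\<pi> c \<noteq> p" "\<pi> c \<noteq> q" using assms(5,6) by (metis bij_is_inj injD)+
  then have "(Transposition.transpose (\<pi> c) r \<circ> \<pi>) a = p" "(Transposition.transpose (\<pi> c) r \<circ> \<pi>) b = q"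
    using \<pi> assms by (simp_all add: transpose_apply_other)
  then show ?thesis
    using \<pi>(1) by (intro that[of "Transposition.transpose (\<pi> c) r \<circ> \<pi>"]) (auto intro: bij_comp)
qed

lemma VL_act_sign_UNIV: "VL_act (sign_aut UNIV) v = - v"
  by (rule VL_eqI) simp

text \<open>
  The central symmetry $x_a \mapsto x_a^{-1}$ acts on $V$ by $-1$ and commutes with all signed
  permutations, so twice a crossed homomorphism can be normalized to vanish on these.
\<close>

lemma crossed_hom_double_normalized:
  assumes f: "crossed_hom f" and comm: "sign_aut UNIV * w = w * sign_aut UNIV"
  shows "f w + f w + (VL_act w (f (sign_aut UNIV)) - f (sign_aut UNIV)) = 0"
proof -
  have "f (sign_aut UNIV) - f w = f w + VL_act w (f (sign_aut UNIV))"
    using arg_cong[OF comm, of f] by (simp add: crossed_hom_times[OF f] VL_act_sign_UNIV)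
  then show ?thesis by (simp add: algebra_simps)
qed

lemma sign_UNIV_commute:
  "sign_aut UNIV * sign_aut S = sign_aut S * sign_aut UNIV"
  "bij \<pi> \<Longrightarrow> sign_aut UNIV * perm_aut \<pi> = perm_aut \<pi> * sign_aut UNIV"
  by (rule aut_eqI; simp)+

lemma transvection_commute:
  "p \<noteq> q \<Longrightarrow> p \<notin> S \<Longrightarrow> q \<notin> S \<Longrightarrow>
    sign_aut S * transvection p q = transvection p q * sign_aut S"
  "p \<noteq> q \<Longrightarrow> bij \<pi> \<Longrightarrow> \<pi> p = p \<Longrightarrow> \<pi> q = q \<Longrightarrow>
    perm_aut \<pi> * transvection p q = transvection p q * perm_aut \<pi>"
proof -
  show "sign_aut S * transvection p q = transvection p q * sign_aut S"
    if "p \<noteq> q" "p \<notin> S" "q \<notin> S"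
    using that by (intro aut_eqI) auto
  assume h: "p \<noteq> q" "bij \<pi>" "\<pi> p = p" "\<pi> q = q"
  then have "\<pi> a \<noteq> p" if "a \<noteq> p" for a using that by (metis bij_is_inj injD)
  then have "ract (perm_aut \<pi> * transvection p q) (fgen a) =
      ract (transvection p q * perm_aut \<pi>) (fgen a)" for a
    by (cases "a = p") (simp_all add: h)
  then show "perm_aut \<pi> * transvection p q = transvection p q * perm_aut \<pi>"
    by (rule aut_eqI)
qed

lemma transvection_sign_transvection:
  "p \<noteq> q \<Longrightarrow> transvection p q * (sign_aut {q} * transvection p q) = sign_aut {q}"
  by (rule aut_eqI) (auto simp: add.assoc)

section \<open>Coefficients in a domain without 2-torsion\<close>

context
  assumes double_eq_zero: "\<And>a :: 'l::idom. a + a = 0 \<Longrightarrow> a = 0"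
begin

lemma uminus_eq_self: "a = - a \<Longrightarrow> a = (0 :: 'l)"
  by (metis add.right_inverse double_eq_zero)

lemma double_inject: "a + a = b + b \<Longrightarrow> a = (b :: 'l)"
  using double_eq_zero[of "a - b"] by (simp add: algebra_simps)

text \<open>Sign changes away from p and q kill every coefficient in which some other index occurs
  an odd number of times. Permutations fixing p and q identify the coefficients of e_x^* (x) e_x ^
  e_q. The relation with the sign change at q kills those of e_q^* (x) e_p ^ e_q and e_x^* (x) e_x ^
  e_p.\<close>

lemma normalized_transvection:
  fixes g :: "'n::finite aut \<Rightarrow> ('n, 'l) VL"
  assumes g: "crossed_hom g" and perm: "\<And>\<pi>. bij \<pi> \<Longrightarrow> g (perm_aut \<pi>) = 0"
    and sign: "\<And>S. g (sign_aut S) = 0"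
    and ne: "p \<noteq> q" "c \<noteq> p" "c \<noteq> q"
  defines "G \<equiv> g (transvection p q)"
  shows "co G k i j =
    co G c c q * ((if i = k \<and> j = q then 1 else 0) - (if j = k \<and> i = q then 1 else 0)) +
    (co G p p q - co G c c q) *
      (if k = p then (if i = p \<and> j = q then 1 else 0) - (if i = q \<and> j = p then 1 else 0) else 0)"
proof -
  have sign_inv: "VL_act (sign_aut S) G = G" if "p \<notin> S" "q \<notin> S" for S
    using arg_cong[OF transvection_commute(1)[OF ne(1) that], of g]
    by (simp add: crossed_hom_times[OF g] sign VL_act_zero G_def)
  have perm_inv: "VL_act (perm_aut \<pi>) G = G" if "bij \<pi>" "\<pi> p = p" "\<pi> q = q" for \<pi>
    using arg_cong[OF transvection_commute(2)[OF ne(1) that], of g] that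
    by (simp add: crossed_hom_times[OF g] perm VL_act_zero G_def)
  have rel: "G + VL_act (transvection p q) (VL_act (sign_aut {q}) G) = 0"
    using arg_cong[OF transvection_sign_transvection[OF ne(1)], of g]
    by (simp add: crossed_hom_times[OF g] sign G_def)
  \<comment> \<open>The nested inequality is an exclusive or: \<open>x\<close> occurs an odd number
    of times among \<open>k\<close>, \<open>i\<close>, \<open>j\<close>.\<close>
  have odd: "co G k i j = 0"
    if "x \<noteq> p" "x \<noteq> q" "(k = x) \<noteq> ((i = x) \<noteq> (j = x))" for x k i j
    using arg_cong[OF sign_inv[of "{x}"], of "\<lambda>v. co v k i j"] that
    by (auto intro!: uminus_eq_self split: if_splits)
  have rel_co: "co G k i j + co (VL_act (transvection p q) (VL_act (sign_aut {q}) G)) k i j = 0" for k i j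
    by (metis rel co_simps(1,2))
  note co_t = co_transvection[OF ne(1), of "VL_act (sign_aut {q}) G"]
  \<comment> \<open>Here q occurs twice, and in \<open>xxp\<close> below not at all, so the sign
    change at q acts trivially; the relation then says that twice the coefficient is zero.\<close>
  have "co (VL_act (transvection p q) (VL_act (sign_aut {q}) G)) q p q = co G q p q"
    unfolding co_t using ne by (simp add: co_alternating(1))
  then have ppq: "co G q p q = 0" using rel_co[of q p q] double_eq_zero by metis
  have xxp: "co G x x p = 0" if "x \<noteq> p" "x \<noteq> q" for x
  proof -
    have "co (VL_act (transvection p q) (VL_act (sign_aut {q}) G)) x x p = co G x x p"
      unfolding co_t using ne that by simp
    then show ?thesis using rel_co[of x x p] double_eq_zero by metis
  qed
  have xxq: "co G x x q = co G c c q" if x: "x \<noteq> p" "x \<noteq> q" for x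
  proof -
    obtain \<pi> where "bij \<pi>" "\<pi> p = p" "\<pi> q = q" "\<pi> c = x"
      using ex_bij_triple[OF ne(1) ne(1) x ne(2,3)] .
    then show ?thesis
      using arg_cong[OF perm_inv[of \<pi>], of "\<lambda>v. co v c c q"] by simp
  qed
  have main: "co G k i j =
    co G c c q * ((if i = k \<and> j = q then 1 else 0) - (if j = k \<and> i = q then 1 else 0)) +
    (co G p p q - co G c c q) *
      (if k = p then (if i = p \<and> j = q then 1 else 0) - (if i = q \<and> j = p then 1 else 0) else 0)"
    \<comment> \<open>Up to exchanging \<open>i\<close> and \<open>j\<close> these are all the
      pairs; the rest follow by antisymmetry.\<close>
    if cond: "j = q \<or> (i \<noteq> q \<and> j = p) \<or> (i \<noteq> q \<and> i \<noteq> p)" for i j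
  proof (cases "i = j")
    case True
    then show ?thesis using ne(1) by (auto simp: co_alternating(1))
  next
    case False
    consider "i = p" "j = q" | "i \<noteq> p" "i \<noteq> q" "j = q" | "i \<noteq> p" "i \<noteq> q" "j = p"
      | "i \<noteq> p" "i \<noteq> q" "j \<noteq> p" "j \<noteq> q"
      using cond False by blast
    then show ?thesis
    proof cases
      case 1
      consider "k = p" | "k = q" | "k \<noteq> p" "k \<noteq> q" by blast
      then show ?thesis
      proof cases
        case 3
        then have "co G k p q = 0" by (intro odd[of k]) auto
        then show ?thesis using 1 3 by simp
      qed (use 1 ne ppq in simp_all)
    next
      case 2
      show ?thesis
      proof (cases "k = i")
        case True
        then show ?thesis using 2 xxq[of i] by simp
      next
        case False
        then have "co G k i q = 0" using 2 by (intro odd[of i]) auto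
        then show ?thesis using 2 False ne by simp
      qed
    next
      case 3
      have "co G k i p = 0"
      proof (cases "k = i")
        case False
        then show ?thesis using 3 by (intro odd[of i]) auto
      qed (use 3 xxp in simp)
      then show ?thesis using 3 ne by simp
    next
      case 4
      have "co G k i j = 0"
        using 4 False by (cases "k = i") (auto intro: odd[of i] odd[of j])
      then show ?thesis using 4 by simp
    qed
  qed
  show ?thesis
  proof (cases "j = q \<or> (i \<noteq> q \<and> j = p) \<or> (i \<noteq> q \<and> i \<noteq> p)")
    case True
    then show ?thesis by (rule main)
  next
    case False
    then have "i = q \<or> (j \<noteq> q \<and> i = p) \<or> (j \<noteq> q \<and> j \<noteq> p)" by auto
    then have "co G k i j = - (co G c c q *
        ((if j = k \<and> i = q then 1 else 0) - (if i = k \<and> j = q then 1 else 0)) +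
      (co G p p q - co G c c q) *
        (if k = p then (if j = p \<and> i = q then 1 else 0) - (if j = q \<and> i = p then 1 else 0) else 0))"
      using main[of i j] co_swap[of G k i j] by metis
    then show ?thesis
      by (simp only: conj_commute[of "j = p"] conj_commute[of "j = q" "i = p"]) (simp add: algebra_simps)
  qed
qed

text \<open>The halves are alternating because twice each relation holds and 2 can be
  cancelled.\<close>

lemma VL_halve:
  fixes v :: "('n::finite, 'l) VL"
  assumes "\<And>k i j. 2 dvd co v k i j"
  shows "\<exists>w. v = w + w"
proof -
  have "\<exists>x. co v k i j = x + x" for k i j
    using assms[of k i j] by (metis dvdE mult_2)
  then obtain h where h: "\<And>k i j. co v k i j = h k i j + h k i j" by metis
  have "alternating (\<chi> i j. h k i j)" for k
  proof -
    have "h k i i = 0" for i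
      by (rule double_eq_zero) (metis h co_alternating(1))
    moreover have "h k i j + h k j i = 0" for i j
      by (rule double_eq_zero) (metis h co_alternating(2) add.assoc add.commute)
    ultimately show ?thesis by (simp add: alternating_def)
  qed
  then have "co (\<chi> k. Abs_ext2 (\<chi> i j. h k i j)) k i j = h k i j" for k i j
    by (simp add: co_def Abs_ext2_inverse)
  then have "v = (\<chi> k. Abs_ext2 (\<chi> i j. h k i j)) + (\<chi> k. Abs_ext2 (\<chi> i j. h k i j))"
    by (intro VL_eqI) (simp add: h)
  then show ?thesis by blast
qed

lemma VL_double_inject:
  fixes v w :: "('n::finite, 'l) VL"
  assumes "v + v = w + w"
  shows "v = w"
proof (rule VL_eqI)
  fix k i j
  have "co v k i j + co v k i j = co w k i j + co w k i j"
    using arg_cong[OF assms, of "\<lambda>u. co u k i j"] by simp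
  then show "co v k i j = co w k i j" by (rule double_inject)
qed

text \<open>
  The coefficients excluded from the second hypothesis include those at which the normalized
  Kawazumi class does not vanish on the transvection.
\<close>

lemma even_coboundary:
  fixes m :: "('n::finite, 'l) VL"
  assumes perm: "\<And>\<pi> k i j. bij \<pi> \<Longrightarrow> 2 dvd co (VL_act (perm_aut \<pi>) m - m) k i j"
    and trans: "\<And>k i j. k \<noteq> p \<or> i \<notin> {p, q} \<Longrightarrow> 2 dvd co (VL_act (transvection p q) m - m) k i j"
    and ne: "p \<noteq> q" "c \<noteq> p" "c \<noteq> q" "d \<noteq> p" "d \<noteq> q" "c \<noteq> d"
  shows "2 dvd co m k i j"
proof -
  \<comment> \<open>Divisibility by 2 of a coefficient is constant along the permutation orbits of
    index triples.\<close>
  have move: "2 dvd co m k i j" if "bij \<pi>" "2 dvd co m (\<pi> k) (\<pi> i) (\<pi> j)" for \<pi> k i j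
    using dvd_diff[OF that(2) perm[OF that(1), of k i j]] that(1) by simp
  \<comment> \<open>At (p, c, d) the coboundary on E is \<open>co m q c d\<close>, and at (c, c, q),
    used below, it is \<open>- co m c c p\<close>. Up to antisymmetry the orbits of these two
    triples contain all coefficients not zero by alternation.\<close>
  have "2 dvd co m q c d"
    using trans[of p c d] ne by (simp add: co_transvection)
  then have distinct: "2 dvd co m k i j" if *: "k \<noteq> i" "j \<noteq> k" "j \<noteq> i" for k i j
    using ex_bij_triple[OF ne(3)[symmetric] *(1) ne(5) ne(6)[symmetric] *(2,3)] move by metis
  have "2 dvd co m c c p"
    using trans[of c c q] ne by (simp add: co_transvection)
  then have repeated: "2 dvd co m k k j" if "k \<noteq> j" for k j
    using ex_bij_pair[OF ne(2) that] move by metis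
  show ?thesis
  proof (cases "i = j")
    case True
    then show ?thesis by (simp add: co_alternating(1))
  next
    case False
    then consider "k = i" | "k = j" | "k \<noteq> i" "k \<noteq> j" by blast
    then show ?thesis
    proof cases
      case 1
      then show ?thesis using repeated[of k j] False by simp
    next
      case 2
      then show ?thesis using repeated[of k i] False co_swap[of m k k i] by simp
    next
      case 3
      then show ?thesis using distinct[of k i j] False by simp
    qed
  qed
qed

lemma crossed_hom_decomposition:
  fixes f FM FK :: "'n::finite aut \<Rightarrow> ('n, 'l) VL" and mM mK :: "('n, 'l) VL"
  defines "gM \<equiv> \<lambda>s. FM s + FM s + (VL_act s mM - mM)"
    and "gK \<equiv> \<lambda>s. FK s + (VL_act s mK - mK)"
  assumes crossed: "crossed_hom f" "crossed_hom FM" "crossed_hom FK"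
    and perm: "\<And>\<pi>. bij \<pi> \<Longrightarrow> gM (perm_aut \<pi>) = 0" "\<And>\<pi>. bij \<pi> \<Longrightarrow> gK (perm_aut \<pi>) = 0"
    and sign: "\<And>S. gM (sign_aut S) = 0" "\<And>S. gK (sign_aut S) = 0"
    and trans: "\<And>k i j. co (gM (transvection p q)) k i j =
        (if j = k \<and> i = q then 1 else 0) - (if i = k \<and> j = q then 1 else 0)"
      "\<And>k i j. co (gK (transvection p q)) k i j =
        (if k = p then (if i = q \<and> j = p then 1 else 0) - (if i = p \<and> j = q then 1 else 0) else 0)"
    and ne: "p \<noteq> q" "c \<noteq> p" "c \<noteq> q" "d \<noteq> p" "d \<noteq> q" "c \<noteq> d"
  shows "\<exists>\<alpha> \<beta> m. \<forall>s. f s = VL_scale \<alpha> (FM s) + VL_scale \<beta> (FK s) + (VL_act s m - m)"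
proof -
  define m0 where "m0 = f (sign_aut UNIV)"
  define g where "g = (\<lambda>s. f s + f s + (VL_act s m0 - m0))"
  have g: "crossed_hom g"
    unfolding g_def by (intro crossed_hom_add crossed crossed_hom_principal)
  have gM: "crossed_hom gM"
    unfolding gM_def by (intro crossed_hom_add crossed crossed_hom_principal)
  have gK: "crossed_hom gK"
    unfolding gK_def by (intro crossed_hom_add crossed crossed_hom_principal)
  have g_perm: "g (perm_aut \<pi>) = 0" if "bij \<pi>" for \<pi>
    unfolding g_def m0_def
    by (rule crossed_hom_double_normalized[OF crossed(1) sign_UNIV_commute(2)[OF that]])
  have g_sign: "g (sign_aut S) = 0" for S
    unfolding g_def m0_def
    by (rule crossed_hom_double_normalized[OF crossed(1) sign_UNIV_commute(1)])
  \<comment> \<open>The pair (A, D) is (-1, -1) for \<open>gM\<close> and (-1, 0) for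
    \<open>gK\<close>, which dictates the coefficients in \<open>h\<close>.\<close>
  define A D where "A = co (g (transvection p q)) p p q" and "D = co (g (transvection p q)) c c q"
  define h where "h = (\<lambda>s. g s - (VL_scale (- D) (gM s) + VL_scale (D - A) (gK s)))"
  have "crossed_hom h"
    unfolding h_def by (intro crossed_hom_add crossed_hom_diff crossed_hom_scale g gM gK)
  moreover have "VL_scale r (0 :: ('n, 'l) VL) = 0" for r
    by (rule VL_eqI) simp
  then have "bij \<pi> \<Longrightarrow> h (perm_aut \<pi>) = 0" "h (sign_aut S) = 0" for \<pi> S
    by (simp_all add: h_def g_perm g_sign perm sign)
  moreover have "h (transvection p q) = 0"
  proof (rule VL_eqI)
    fix k i j
    define X Y :: 'l where "X = (if i = k \<and> j = q then 1 else 0) - (if j = k \<and> i = q then 1 else 0)"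
      and "Y = (if k = p then (if i = p \<and> j = q then 1 else 0) - (if i = q \<and> j = p then 1 else 0) else 0)"
    have "co (gM (transvection p q)) k i j = - X" "co (gK (transvection p q)) k i j = - Y"
      unfolding trans X_def Y_def by simp_all
    moreover have "co (g (transvection p q)) k i j = D * X + (A - D) * Y"
      unfolding A_def D_def X_def Y_def by (rule normalized_transvection[OF g g_perm g_sign ne(1-3)])
    ultimately show "co (h (transvection p q)) k i j = co 0 k i j"
      by (simp add: h_def algebra_simps)
  qed
  ultimately have h: "h s = 0" for s
    using crossed_hom_eq_zero[of h p q s] ne(1) by blast
  define f' where "f' = (\<lambda>s. f s - VL_scale (- D) (FM s))"
  define m where "m = VL_scale (- D) mM - m0"
  have f': "f' s + f' s = VL_scale (D - A) (gK s) + (VL_act s m - m)" for s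
    using h[of s]
    by (simp add: h_def g_def gM_def f'_def m_def VL_act_simps VL_scale_simps VL_scale_diff algebra_simps)
  \<comment> \<open>So the coboundary of \<open>m\<close> is even wherever \<open>gK\<close>
    vanishes: on permutations and, on E, away from e_p^* (x) e_p ^ e_q.\<close>
  have f'_co: "co (VL_act s m - m) k i j = 2 * co (f' s) k i j - (D - A) * co (gK s) k i j" for s k i j
    using arg_cong[OF f'[of s], of "\<lambda>v. co v k i j"] by (simp add: algebra_simps)
  have "2 dvd co m k i j" for k i j
  proof (rule even_coboundary[OF _ _ ne])
    show "2 dvd co (VL_act (perm_aut \<pi>) m - m) k i j" if "bij \<pi>" for \<pi> k i j
      unfolding f'_co perm(2)[OF that] by simp
    show "2 dvd co (VL_act (transvection p q) m - m) k i j" if "k \<noteq> p \<or> i \<notin> {p, q}" for k i j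
      unfolding f'_co trans using that by (auto simp: dvd_diff)
  qed
  then obtain m' where m': "m = m' + m'" using VL_halve by blast
  \<comment> \<open>With \<open>m\<close> even, the coefficient at which \<open>gK\<close> is -1
    shows that D - A is even.\<close>
  have "co (VL_act (transvection p q) m - m) p p q = 2 * co (f' (transvection p q)) p p q + (D - A)"
    unfolding f'_co trans using ne(1) by simp
  then have "D - A = 2 * (co (VL_act (transvection p q) m' - m') p p q - co (f' (transvection p q)) p p q)"
    by (simp add: m' VL_act_add algebra_simps)
  then obtain \<beta> where \<beta>: "D - A = \<beta> + \<beta>" by (metis mult_2)
  have "f' s = VL_scale \<beta> (gK s) + (VL_act s m' - m')" for s
  proof (rule VL_double_inject)
    show "f' s + f' s = VL_scale \<beta> (gK s) + (VL_act s m' - m') + (VL_scale \<beta> (gK s) + (VL_act s m' - m'))"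
      unfolding f' \<beta> VL_scale_simps(2) by (simp add: m' VL_act_add algebra_simps)
  qed
  \<comment> \<open>Undoing the normalization of \<open>FK\<close> moves
    \<open>VL_scale \<beta> mK\<close> into the coboundary.\<close>
  then have "f s = VL_scale (- D) (FM s) + VL_scale \<beta> (FK s) +
      (VL_act s (VL_scale \<beta> mK + m') - (VL_scale \<beta> mK + m'))" for s
    unfolding f'_def gK_def by (simp add: VL_act_simps VL_scale_simps VL_scale_diff algebra_simps)
  then show ?thesis by blast
qed

end

lemma coh_class_eqI:
  "(\<And>s. f s = g s + (VL_act s m - m)) \<Longrightarrow> coh_class f = coh_class g"
  by (subst coh.abs_eq_iff) (auto simp: cohomologous_def principal_crossed_hom_def)

theorem mainTheorem2:
  fixes \<theta> :: "'n::finite free_group \<Rightarrow> 'n ctensor"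
  assumes rank: "CARD('n) \<ge> 5"
    and pid: "\<And>I :: 'l::idom set. module.subspace (*) I \<Longrightarrow> \<exists>a. I = module.span (*) {a}"
    and no_two_torsion: "\<And>a :: 'l. 2 * a = 0 \<Longrightarrow> a = 0"
    and magnus: "magnus_expansion \<theta>"
  shows "crossed_hom (f_M :: 'n aut \<Rightarrow> ('n, 'l) VL) \<and>
    crossed_hom (f_K \<theta> :: 'n aut \<Rightarrow> ('n, 'l) VL) \<and>
    module.span coh_scale {coh_class f_M, coh_class (f_K \<theta>)} = (H1 :: ('n, 'l) coh set)"
proof -
  \<comment> \<open>The indices p and q carry the transvection; c and d are the spectators of the
    parity argument.\<close>
  have "4 \<le> card (UNIV :: 'n set)" using rank by simp
  then obtain P :: "'n set" where "card P = 4" by (rule obtain_subset_with_card_n)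
  then obtain p q c d :: 'n
    where "p \<noteq> q" "c \<noteq> p" "c \<noteq> q" "d \<noteq> p" "d \<noteq> q" "c \<noteq> d"
    by (auto simp: card_Suc_eq numeral_eq_Suc)
  note ne = this
  let ?M = "f_M :: 'n aut \<Rightarrow> ('n, 'l) VL" and ?K = "f_K \<theta> :: 'n aut \<Rightarrow> ('n, 'l) VL"
  let ?mM = "VL_of_int morita_shift :: ('n, 'l) VL"
    and ?mK = "VL_of_int (expansion_shift \<theta>) :: ('n, 'l) VL"
  have M_def: "f_M s = VL_of_int (morita s)" for s by (simp add: f_M_def morita_def)
  have K_def: "f_K \<theta> s = VL_of_int (kawazumi \<theta> s)" for s by (rule f_K_kawazumi[OF magnus])
  have M: "crossed_hom ?M"
    unfolding M_def[abs_def] by (rule crossed_hom_of_int[OF crossed_hom_morita[OF ne(1)]])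
  have K: "crossed_hom ?K"
    unfolding K_def[abs_def] by (rule crossed_hom_of_int[OF crossed_hom_kawazumi[OF magnus]])
  have normM: "f_M s + f_M s + (VL_act s ?mM - ?mM) =
      VL_of_int (morita s + morita s + (VL_act s morita_shift - morita_shift))" for s
    by (simp only: M_def VL_of_int_simps VL_act_of_int)
  have normK: "f_K \<theta> s + (VL_act s ?mK - ?mK) =
      VL_of_int (kawazumi \<theta> s + (VL_act s (expansion_shift \<theta>) - expansion_shift \<theta>))" for s
    by (simp only: K_def VL_of_int_simps VL_act_of_int)
  have letter: "\<exists>l. fgen a = fletter l" "\<exists>l. - fgen a = fletter l" for a :: 'n
    by (metis fletter_simps)+
  have double: "a = 0" if "a + a = 0" for a :: 'l
    using no_two_torsion[of a] that by (simp add: mult_2)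
  have decomposition: "\<exists>\<alpha> \<beta> m. \<forall>s. f s = VL_scale \<alpha> (f_M s) + VL_scale \<beta> (f_K \<theta> s) + (VL_act s m - m)"
    if "crossed_hom f" for f :: "'n aut \<Rightarrow> ('n, 'l) VL"
  proof (rule crossed_hom_decomposition[OF double that M K _ _ _ _ _ _ ne, of ?mM ?mK])
    fix \<pi> :: "'n \<Rightarrow> 'n" and S and k i j :: 'n
    show "f_M (perm_aut \<pi>) + f_M (perm_aut \<pi>) + (VL_act (perm_aut \<pi>) ?mM - ?mM) = 0" if "bij \<pi>"
      unfolding normM by (simp only: morita_normalized_perm[OF that] VL_of_int_simps)
    show "f_K \<theta> (perm_aut \<pi>) + (VL_act (perm_aut \<pi>) ?mK - ?mK) = 0" if "bij \<pi>"
      unfolding normK using that letter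
      by (subst kawazumi_normalized_signed_perm[OF magnus]) (simp_all add: VL_of_int_simps)
    show "f_M (sign_aut S) + f_M (sign_aut S) + (VL_act (sign_aut S) ?mM - ?mM) = 0"
      unfolding normM by (simp only: morita_normalized_sign VL_of_int_simps)
    show "f_K \<theta> (sign_aut S) + (VL_act (sign_aut S) ?mK - ?mK) = 0"
      unfolding normK using letter
      by (subst kawazumi_normalized_signed_perm[OF magnus]) (simp_all add: VL_of_int_simps)
    show "co (f_M (transvection p q) + f_M (transvection p q) + (VL_act (transvection p q) ?mM - ?mM)) k i j =
        (if j = k \<and> i = q then 1 else 0) - (if i = k \<and> j = q then 1 else 0)"
      unfolding normM co_VL_of_int morita_normalized_transvection[OF ne(1)]
      by (simp only: of_int_diff if_mult_zero(3) of_int_1)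
    show "co (f_K \<theta> (transvection p q) + (VL_act (transvection p q) ?mK - ?mK)) k i j =
        (if k = p then (if i = q \<and> j = p then 1 else 0) - (if i = p \<and> j = q then 1 else 0) else 0)"
      unfolding normK co_VL_of_int kawazumi_normalized_transvection[OF magnus ne(1)]
      by (simp only: of_int_diff if_mult_zero(3) of_int_1)
  qed
  have "coh.span {coh_class ?M, coh_class ?K} \<subseteq> H1"
    using M K by (intro coh.span_minimal subspace_H1) (auto simp: H1_def)
  moreover have "x \<in> coh.span {coh_class ?M, coh_class ?K}" if x: "x \<in> H1" for x
  proof -
    obtain f where f: "x = coh_class f" "crossed_hom f" using x by (auto simp: H1_def)
    then obtain \<alpha> \<beta> m where
      "\<And>s. f s = VL_scale \<alpha> (f_M s) + VL_scale \<beta> (f_K \<theta> s) + (VL_act s m - m)"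
      using decomposition by metis
    then have "x = coh_scale \<alpha> (coh_class ?M) + coh_scale \<beta> (coh_class ?K)"
      unfolding f(1) coh_scale.abs_eq plus_coh.abs_eq by (rule coh_class_eqI)
    then show ?thesis by (simp add: coh.span_add coh.span_scale coh.span_base)
  qed
  ultimately show ?thesis using M K by blast
qed

end
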